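(* Let $p$ and $q$ be prime numbers with $1<q<p$, let $G=\mathbb{Z}_p\times\mathbb{Z}_q$, and let $k\in\mathfrak M$. Then the following hold. (i) If $k\le q$, the equality cases for $(k,G)$ are exactly the functions of the form $\delta_{\mathbb{Z}_p}(\cdot-a)\otimes f$, with $a\in\mathbb{Z}_p$ and $f\in L(\mathbb{Z}_q)$ such that $|\operatorname{supp} f|=k$ and $|\operatorname{supp}\widehat f|=q-k+1$. (ii) If $q\le k<q\frac{p+1}{q+1}$, there exist equality cases for $(k,G)$ if and only if $k$ is divisible by $q$. When $k=qj$ with $1\le j<\frac{p+1}{q+1}$, the equality cases are exactly the functions of the form $f\otimes\chi$, with $\chi$ a character of $\mathbb{Z}_q$ and $f\in L(\mathbb{Z}_p)$ such that $|\operatorname{supp} f|=j$ and $|\operatorname{supp}\widehat f|=p-j+1$. (iii) If $q\frac{p+1}{q+1}<k\le p$, the equality cases are exactly the functions of the form $f\otimes\delta_{\mathbb{Z}_q}(\cdot-b)$, with $b\in\mathbb{Z}_q$ and $f\in L(\mathbb{Z}_p)$ such that $|\operatorname{supp} f|=k$ and $|\operatorname{supp}\widehat f|=p-k+1$. (iv) If $p\le k<pq-1$, there exist equality cases for $(k,G)$ if and only if $k$ is divisible by $p$. When $k=pj$ with $1\le j\le q-1$, the equality cases are exactly the functions of the form $\chi\otimes f$, with $\chi$ a character of $\mathbb{Z}_p$ and $f\in L(\mathbb{Z}_q)$ such that $|\operatorname{supp} f|=j$ and $|\operatorname{supp}\widehat f|=q-j+1$. For all other values $k\in\mathfrak M$,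 there are no equality cases for $(k,G)$.
   Context: Notation: $\mathbb{Z}_n=\mathbb{Z}/n\mathbb{Z}$. For a finite Abelian group $G$, $L(G)$ is the space of complex functions on $G$, $\widehat G$ is the group of characters of $G$, and $\widehat f(\chi)=\sum_{x\in G}f(x)\chi(-x)$ for $f\in L(G)$, $\chi\in\widehat G$. For $1\le k\le|G|$, Meshulam's function is $$\theta(k,G)=\min\{\,|\operatorname{supp}\widehat f| : f\in L(G),\ f\ne0,\ |\operatorname{supp} f|\le k\}.$$ An equality case for $(k,G)$ is a function $f\in L(G)$ with $|\operatorname{supp} f|=k$ and $|\operatorname{supp}\widehat f|=\theta(k,G)$. $\delta_G=\mathds{1}_{\{0\}}$ is the Dirac mass at $0$ on $G$, and $(g\otimes h)(x,y)=g(x)h(y)$ for $(x,y)\in\mathbb{Z}_p\times\mathbb{Z}_q$. For primes $q<p$, let $F(s,t)=(p-s+1)(q-t+1)$ and, for an integer $k$, let $\Delta_k$ be the set of $(s,t)$ with $1\le s\le p$, $1\le t\le q$ and $st\le k$. $\mathfrak M$ is the set of integers $k$ with $1<k<pq-1$ such that the minimum of $F$ over $\Delta_k\cap(\mathbb{N}\times\mathbb{N})$ is attained at exactly one point $(s,t)$. *)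

theory Defs
  imports Complex_Main "HOL-Computational_Algebra.Primes" "HOL-Algebra.Elementary_Groups"
begin

abbreviation Z :: "nat \<Rightarrow> int monoid"
  where "Z n \<equiv> integer_mod_group n"

text \<open>Complex functions on a group are extensional: they take the value \<open>undefined\<close> off the
  carrier, so that equality in \<open>L G\<close> is equality on the carrier.\<close>

definition L :: "('a, 'b) monoid_scheme \<Rightarrow> ('a \<Rightarrow> complex) set"
  where "L G = carrier G \<rightarrow>\<^sub>E UNIV"

definition supp :: "('a, 'b) monoid_scheme \<Rightarrow> ('a \<Rightarrow> complex) \<Rightarrow> 'a set"
  where "supp G f = {x \<in> carrier G. f x \<noteq> 0}"

definition circle_group :: "complex monoid"
  where "circle_group = \<lparr>carrier = {z. cmod z = 1}, monoid.mult = (*), one = 1\<rparr>"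

definition dual_group :: "('a, 'b) monoid_scheme \<Rightarrow> ('a \<Rightarrow> complex) monoid"
  where "dual_group G =
    \<lparr>carrier = hom G circle_group \<inter> L G,
     monoid.mult = (\<lambda>\<chi> \<psi>. \<lambda>x\<in>carrier G. \<chi> x * \<psi> x),
     one = (\<lambda>x\<in>carrier G. 1)\<rparr>"

definition fourier :: "('a, 'b) monoid_scheme \<Rightarrow> ('a \<Rightarrow> complex) \<Rightarrow> ('a \<Rightarrow> complex) \<Rightarrow> complex"
  where "fourier G f = (\<lambda>\<chi>\<in>carrier (dual_group G). \<Sum>x\<in>carrier G. f x * \<chi> (inv\<^bsub>G\<^esub> x))"

abbreviation fourier_supp :: "('a, 'b) monoid_scheme \<Rightarrow> ('a \<Rightarrow> complex) \<Rightarrow> ('a \<Rightarrow> complex) set"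
  where "fourier_supp G f \<equiv> supp (dual_group G) (fourier G f)"

definition \<theta> :: "nat \<Rightarrow> ('a, 'b) monoid_scheme \<Rightarrow> nat"
  where "\<theta> k G =
    Min {card (fourier_supp G f) | f. f \<in> L G \<and> f \<noteq> (\<lambda>x\<in>carrier G. 0) \<and> card (supp G f) \<le> k}"

definition equality_cases :: "nat \<Rightarrow> ('a, 'b) monoid_scheme \<Rightarrow> ('a \<Rightarrow> complex) set"
  where "equality_cases k G =
    {f \<in> L G. card (supp G f) = k \<and> card (fourier_supp G f) = \<theta> k G}"

definition dirac :: "('a, 'b) monoid_scheme \<Rightarrow> 'a \<Rightarrow> complex"
  where "dirac G = (\<lambda>x\<in>carrier G. if x = \<one>\<^bsub>G\<^esub> then 1 else 0)"

definition translate :: "('a, 'b) monoid_scheme \<Rightarrow> 'a \<Rightarrow> ('a \<Rightarrow> complex) \<Rightarrow> 'a \<Rightarrow> complex"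
  where "translate G a f = (\<lambda>x\<in>carrier G. f (x \<otimes>\<^bsub>G\<^esub> inv\<^bsub>G\<^esub> a))"

definition tensor :: "('a, 'c) monoid_scheme \<Rightarrow> ('b, 'd) monoid_scheme \<Rightarrow>
    ('a \<Rightarrow> complex) \<Rightarrow> ('b \<Rightarrow> complex) \<Rightarrow> 'a \<times> 'b \<Rightarrow> complex"
  where "tensor G H g h = (\<lambda>(x, y)\<in>carrier (G \<times>\<times> H). g x * h y)"

definition F :: "nat \<Rightarrow> nat \<Rightarrow> real \<times> real \<Rightarrow> real"
  where "F p q = (\<lambda>(s, t). (real p - s + 1) * (real q - t + 1))"

definition \<Delta> :: "nat \<Rightarrow> nat \<Rightarrow> nat \<Rightarrow> (real \<times> real) set"
  where "\<Delta> p q k =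
    {(s, t). 1 \<le> s \<and> s \<le> real p \<and> 1 \<le> t \<and> t \<le> real q \<and> s * t \<le> real k}"

definition \<MM> :: "nat \<Rightarrow> nat \<Rightarrow> nat set"
  where "\<MM> p q = {k. 1 < k \<and> k < p * q - 1 \<and>
    (\<exists>!z. is_arg_min (F p q) (\<lambda>z. z \<in> \<Delta> p q k \<inter> (\<nat> \<times> \<nat>)) z)}"

end

theory Submission
  imports Defs "Jordan_Normal_Form.Char_Poly"
begin

text \<open>
  On a cyclic group of prime order \<open>p\<close>, Chebotarev's theorem on minors of the Fourier matrix gives the
  uncertainty principle \<open>|supp f| + |supp f^| \<ge> p + 1\<close>, and it is sharp. It is proved by reduction
  modulo \<open>1 - w\<close>: an integer polynomial vanishing at a \<open>p\<close>-th root of unity \<open>w\<close> has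
  value divisible by \<open>p\<close> at \<open>1\<close>.

  For \<open>f\<close> on the product group, let \<open>s\<close> be the number of nonzero rows and \<open>t\<close> the smallest support of
  a nonzero row. A row with \<open>t\<close> nonzero entries shows that at least \<open>q - t + 1\<close> of the row-wise Fourier
  columns are nonzero; each of them is supported on at most \<open>s\<close> points, so that the transform of
  \<open>f\<close> has at least \<open>(p - s + 1) (q - t + 1)\<close> nonzero values, where \<open>s t \<le> k\<close>. In
  an equality case \<open>(s, t)\<close> is the unique minimiser, and all these inequalities are tight; applying
  this to rows and to columns shows that the support of \<open>f\<close> is an \<open>s \<times> t\<close> grid and that \<open>k = s t\<close>.
  Comparing grid values shows that the minimiser is one of \<open>(1, k)\<close>, \<open>(k div q, q)\<close>, \<open>(k, 1)\<close>,
  \<open>(p, k div p)\<close>, so that \<open>f\<close> splits as a tensor product. At the threshold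
  \<open>k (q + 1) = q (p + 1)\<close> the second and third candidates tie.
\<close>

subsection \<open>Chebotarev's theorem on roots of unity\<close>


abbreviation ipoly :: "int poly \<Rightarrow> complex \<Rightarrow> complex"
  where "ipoly g w \<equiv> poly (map_poly of_int g) w"

lemma ipoly_eq_sum: "ipoly g w = (\<Sum>m\<le>degree g. of_int (coeff g m) * w ^ m)"
proof -
  have "degree (map_poly of_int g :: complex poly) = degree g"
    by (rule degree_map_poly) auto
  then show ?thesis
    by (simp add: poly_altdef coeff_map_poly)
qed

lemma ipoly_hom: "comm_ring_hom (\<lambda>g. ipoly g w)"
  by unfold_locales (auto simp: of_int_poly_hom.hom_add of_int_poly_hom.hom_mult)

lemma power_mod_root:
  assumes "z ^ n = (1 :: complex)" shows "z ^ (m mod n) = z ^ m"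
proof -
  have "z ^ m = z ^ (n * (m div n) + m mod n)" by simp
  also have "\<dots> = z ^ (m mod n)" by (simp only: power_add power_mult assms power_one mult_1_left)
  finally show ?thesis by simp
qed

text \<open>Multiplication by \<open>ipoly h w\<close> acts on the powers
  \<open>1, w, ..., w ^ (n - 1)\<close> through an integer matrix, so \<open>ipoly h w\<close> is a
  root of a monic integer polynomial, and a rational algebraic integer is an integer. This replaces
  any appeal to the minimal polynomial of \<open>w\<close>.\<close>

lemma ipoly_root_of_unity_Rats_imp_Ints:
  assumes n: "n > 0" and w: "w ^ n = 1" and rat: "ipoly h w \<in> \<rat>"
  shows "ipoly h w \<in> \<int>"
proof -
  \<comment> \<open>Multiply \<open>h\<close> by the \<open>i\<close>-th power of the variable and
    fold exponents modulo \<open>n\<close>: \<open>c i j\<close> is the coefficient that lands on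
    exponent \<open>j\<close>. The fold keeps the value at \<open>w\<close> because
    \<open>w ^ n = 1\<close>.\<close>
  define c where "c = (\<lambda>i j. \<Sum>m | m \<le> degree h \<and> (i + m) mod n = j. coeff h m)"
  define W where "W = mat n n (\<lambda>(i, j). c i j)"
  define v where "v = vec n (\<lambda>j. w ^ j)"
  have row: "(\<Sum>j<n. of_int (c i j) * w ^ j) = ipoly h w * w ^ i" for i
  proof -
    have "(\<Sum>j<n. of_int (c i j) * w ^ j)
        = (\<Sum>j<n. \<Sum>m | m \<in> {..degree h} \<and> (i + m) mod n = j. of_int (coeff h m) * w ^ (i + m))"
      unfolding c_def of_int_sum sum_distrib_right
      by (intro sum.cong refl) (auto simp: power_mod_root[OF w])
    also have "\<dots> = (\<Sum>m\<in>{..degree h}. of_int (coeff h m) * w ^ (i + m))"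
      by (rule sum.group) (use n in auto)
    also have "\<dots> = ipoly h w * w ^ i"
      unfolding ipoly_eq_sum sum_distrib_right by (intro sum.cong refl) (simp add: power_add)
    finally show ?thesis .
  qed
  have W: "W \<in> carrier_mat n n" by (simp add: W_def)
  have W': "map_mat of_int W \<in> carrier_mat n n" by (simp add: W_def)
  have "eigenvector (map_mat of_int W) v (ipoly h w)"
    unfolding eigenvector_def
  proof (intro conjI)
    show "v \<in> carrier_vec (dim_row (map_mat of_int W))" by (simp add: v_def W_def)
    have "v $ 0 \<noteq> 0\<^sub>v n $ 0" using n by (simp add: v_def)
    then show "v \<noteq> 0\<^sub>v (dim_row (map_mat of_int W))" by (auto simp: W_def)
    show "map_mat of_int W *\<^sub>v v = ipoly h w \<cdot>\<^sub>v v"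
      by (rule eq_vecI)
         (auto simp: W_def v_def scalar_prod_def row[symmetric] lessThan_atLeast0 intro!: sum.cong)
  qed
  then have "poly (char_poly (map_mat of_int W)) (ipoly h w) = 0"
    using eigenvalue_root_char_poly[OF W'] by (auto simp: eigenvalue_def)
  then have "poly (map_poly of_int (char_poly W)) (ipoly h w) = 0"
    by (simp add: of_int_hom.char_poly_hom[OF W])
  moreover have "lead_coeff (char_poly W) = 1"
    using degree_monic_char_poly[OF W] by simp
  ultimately have "algebraic_int (ipoly h w)"
    by (auto simp: algebraic_int_altdef_ipoly)
  then show ?thesis
    using rat by (rule rational_algebraic_int_is_int)
qed

text \<open>Expand \<open>(1 - w) ^ p\<close> by the binomial theorem: the inner coefficients are
  divisible by \<open>p\<close>, and \<open>w ^ p = 1\<close> turns the two outer terms into an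
  integer.\<close>

lemma one_minus_root_of_unity_power_prime:
  fixes p :: nat
  assumes p: "prime p" and w: "w ^ p = 1"
  obtains V where "(1 - w) ^ p = of_nat p * ipoly V w"
proof -
  interpret comm_ring_hom "\<lambda>g. ipoly g w" by (rule ipoly_hom)
  define V where "V = [:(1 + (-1) ^ p) div int p:] +
    (\<Sum>k\<in>{1..<p}. monom (int ((p choose k) div p) * (-1) ^ k) k)"
  have p2: "p \<ge> 2" using p by (rule prime_ge_2_nat)
  \<comment> \<open>The two outer terms add up to 0 for odd \<open>p\<close> and to 2 for
    \<open>p = 2\<close>, a multiple of \<open>p\<close> in both cases.\<close>
  have ends: "of_nat p * of_int ((1 + (-1) ^ p) div int p) = (1 + (-1) ^ p :: complex)"
  proof (cases "p = 2")
    case False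
    then have "odd p" using p p2 prime_odd_nat by force
    then show ?thesis by simp
  qed auto
  have mid: "of_nat p * of_int (int ((p choose k) div p)) = (of_nat (p choose k) :: complex)"
    if "k \<in> {1..<p}" for k
  proof -
    have "p dvd (p choose k)" by (rule dvd_choose_prime) (use that p in auto)
    then have "p * ((p choose k) div p) = (p choose k)" by simp
    then show ?thesis by (metis of_int_of_nat_eq of_nat_mult)
  qed
  have V: "ipoly V w = of_int ((1 + (-1) ^ p) div int p) +
      (\<Sum>k\<in>{1..<p}. of_int (int ((p choose k) div p)) * (-1) ^ k * w ^ k)"
    unfolding V_def hom_add hom_sum of_int_hom.map_poly_pCons_hom
    by (auto simp: map_poly_monom poly_monom intro!: sum.cong)
  have "(1 - w) ^ p = (- w + 1) ^ p" by (simp add: algebra_simps)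
  also have "\<dots> = (\<Sum>k\<le>p. of_nat (p choose k) * (- w) ^ k)"
    using binomial_ring[of "- w" 1 p] by simp
  also have "{..p} = insert 0 (insert p {1..<p})" using p2 by auto
  also have "(\<Sum>k\<in>\<dots>. of_nat (p choose k) * (- w) ^ k) =
      1 + (-1) ^ p + (\<Sum>k\<in>{1..<p}. of_nat (p choose k) * (- w) ^ k)"
    using p2 w by (simp add: power_minus[of w])
  also have "(\<Sum>k\<in>{1..<p}. of_nat (p choose k) * (- w) ^ k) =
      (\<Sum>k\<in>{1..<p}. of_nat p * (of_int (int ((p choose k) div p)) * (-1) ^ k * w ^ k))"
    by (intro sum.cong refl) (simp only: mid[symmetric] power_minus[of w] mult.assoc)
  also have "1 + (-1) ^ p + \<dots> = of_nat p * ipoly V w"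
    unfolding V distrib_left ends sum_distrib_left ..
  finally show thesis by (rule that)
qed

text \<open>Dividing \<open>g\<close> by \<open>X - 1\<close> and evaluating at \<open>w\<close>
  gives \<open>poly g 1 = (1 - w) * ipoly u w\<close>. The \<open>p\<close>-th power of this is
  \<open>p\<close> times a value of an integer polynomial at \<open>w\<close>; that value is
  rational, hence an integer, so \<open>p\<close> divides \<open>poly g 1 ^ p\<close>.\<close>

lemma prime_dvd_poly_1_if_root_of_unity:
  fixes p :: nat
  assumes p: "prime p" and w: "w ^ p = 1" and g: "ipoly g w = 0"
  shows "int p dvd poly g 1"
proof -
  interpret comm_ring_hom "\<lambda>g. ipoly g w" by (rule ipoly_hom)
  obtain V where V: "(1 - w) ^ p = of_nat p * ipoly V w"
    by (rule one_minus_root_of_unity_power_prime[OF p w])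
  define u where "u = synthetic_div g 1"
  have "ipoly ([:-1, 1:] * u + [:poly g 1:]) w = 0"
    using g synthetic_div_correct'[of 1 g] by (simp add: u_def)
  then have "(w - 1) * ipoly u w + of_int (poly g 1) = 0"
    unfolding hom_add hom_mult of_int_hom.map_poly_pCons_hom by simp
  then have "of_int (poly g 1) = (1 - w) * ipoly u w"
    by (metis add.commute eq_neg_iff_add_eq_0 minus_diff_eq mult_minus_left)
  then have eq: "of_int (poly g 1 ^ p) = of_nat p * ipoly (V * u ^ p) w"
    unfolding of_int_power hom_mult hom_power by (simp only: power_mult_distrib V mult.assoc)
  have p0: "p > 0" using p by (rule prime_gt_0_nat)
  then have "ipoly (V * u ^ p) w = of_int (poly g 1 ^ p) / of_nat p"
    by (simp only: eq) simp
  then have "ipoly (V * u ^ p) w \<in> \<rat>"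
    by (metis Rats_divide Rats_of_int Rats_of_nat)
  then obtain m where "ipoly (V * u ^ p) w = of_int m"
    using ipoly_root_of_unity_Rats_imp_Ints[OF p0 w] by (auto elim: Ints_cases)
  with eq have "(of_int (poly g 1 ^ p) :: complex) = of_int (int p * m)" by simp
  then have "poly g 1 ^ p = int p * m" by (simp only: of_int_eq_iff)
  then have "int p dvd poly g 1 ^ p" by simp
  moreover have "prime (int p)" using p by simp
  ultimately show ?thesis by (rule prime_dvd_power[rotated])
qed

text \<open>\<open>newton_coeff X a k\<close> is the complete homogeneous symmetric polynomial of degree \<open>a - k\<close> in
  \<open>X 0, \<dots>, X k\<close>, i.e. the divided difference of \<open>x ^ a\<close> at these nodes.\<close>

fun newton_coeff :: "(nat \<Rightarrow> 'a::comm_ring_1) \<Rightarrow> nat \<Rightarrow> nat \<Rightarrow> 'a" where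
  "newton_coeff X 0 k = (if k = 0 then 1 else 0)"
| "newton_coeff X (Suc a) 0 = X 0 * newton_coeff X a 0"
| "newton_coeff X (Suc a) (Suc k) = X (Suc k) * newton_coeff X a (Suc k) + newton_coeff X a k"

lemma newton_coeff_eq_0: "a < k \<Longrightarrow> newton_coeff X a k = 0"
  by (induction X a k rule: newton_coeff.induct) auto

text \<open>With all nodes equal to 1 the recursion becomes Pascal's rule. This is how binomial
  coefficients appear when the roots of unity are specialised to 1.\<close>

lemma newton_coeff_const_1: "newton_coeff (\<lambda>_. 1) a k = of_nat (a choose k)"
proof (induction a arbitrary: k)
  case 0
  show ?case by (cases k) simp_all
next
  case (Suc a)
  show ?case by (cases k) (simp_all add: Suc.IH)
qed

lemma (in comm_ring_hom) hom_newton_coeff: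
  "hom (newton_coeff X a k) = newton_coeff (\<lambda>l. hom (X l)) a k"
  by (induction X a k rule: newton_coeff.induct) (auto simp: hom_add hom_mult)

text \<open>Newton interpolation of a monomial, by induction from
  \<open>x * P k = P (Suc k) + X k * P k\<close>. Since \<open>newton_coeff X a k\<close> vanishes
  for \<open>k > a\<close>, any \<open>N \<ge> a\<close> may serve as the bound, so monomials of
  different degrees can share one range of summation.\<close>

lemma power_eq_newton_sum:
  fixes X :: "nat \<Rightarrow> 'a::comm_ring_1"
  shows "a \<le> N \<Longrightarrow> x ^ a = (\<Sum>k\<le>N. newton_coeff X a k * (\<Prod>l<k. x - X l))"
proof (induction a arbitrary: N)
  case 0
  then show ?case by (simp add: if_distrib[of "\<lambda>z. z * _"] cong: if_cong)
next
  case (Suc a)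
  then obtain M where N: "N = Suc M" and M: "a \<le> M" by (cases N) auto
  define P where "P = (\<lambda>k. \<Prod>l<k. x - X l)"
  have P: "P (Suc k) = x * P k - X k * P k" for k
    by (simp add: P_def algebra_simps)
  have "(\<Sum>k\<le>N. newton_coeff X (Suc a) k * P k)
      = (\<Sum>k\<le>N. X k * newton_coeff X a k * P k) + (\<Sum>k\<le>M. newton_coeff X a k * P (Suc k))"
    unfolding N
    by (simp add: sum.atMost_Suc_shift algebra_simps sum.distrib del: sum.atMost_Suc)
  also have "(\<Sum>k\<le>N. X k * newton_coeff X a k * P k) = (\<Sum>k\<le>M. X k * newton_coeff X a k * P k)"
    using M by (simp add: N newton_coeff_eq_0)
  also have "\<dots> + (\<Sum>k\<le>M. newton_coeff X a k * P (Suc k)) = x * (\<Sum>k\<le>M. newton_coeff X a k * P k)"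
    by (simp add: P algebra_simps sum_distrib_left sum_subtractf)
  also have "\<dots> = x ^ Suc a"
    using Suc.IH[OF M] by (simp add: P_def)
  finally show ?case by (simp add: P_def)
qed

text \<open>Coefficients of \<open>\<Prod>l<i. x - c l\<close> in the basis of binomial polynomials \<open>x choose k\<close>.\<close>

fun binomial_coeff :: "(nat \<Rightarrow> int) \<Rightarrow> nat \<Rightarrow> nat \<Rightarrow> int" where
  "binomial_coeff c 0 k = (if k = 0 then 1 else 0)"
| "binomial_coeff c (Suc i) 0 = - c i * binomial_coeff c i 0"
| "binomial_coeff c (Suc i) (Suc k) =
    (int (Suc k) - c i) * binomial_coeff c i (Suc k) + int (Suc k) * binomial_coeff c i k"

lemma binomial_coeff_eq_0: "i < k \<Longrightarrow> binomial_coeff c i k = 0"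
  by (induction c i k rule: binomial_coeff.induct) auto

text \<open>The induction multiplies by \<open>a - c i = (k - c i) + (a - k)\<close> and absorbs the
  factor \<open>a - k\<close> into the next binomial coefficient. As before, the bound
  \<open>N\<close> is free above \<open>i\<close>.\<close>

lemma prod_eq_binomial_sum:
  "i \<le> N \<Longrightarrow> (\<Prod>l<i. int a - c l) = (\<Sum>k\<le>N. binomial_coeff c i k * int (a choose k))"
proof (induction i arbitrary: N)
  case 0
  then show ?case by (simp add: if_distrib[of "\<lambda>z. z * _"] cong: if_cong)
next
  case (Suc i)
  then obtain M where N: "N = Suc M" and M: "i \<le> M" by (cases N) auto
  have absorb: "int (Suc k) * int (a choose Suc k) = (int a - int k) * int (a choose k)" for k
  proof (cases "k \<le> a")
    case True
    have "Suc k * (a choose Suc k) = (a - k) * (a choose k)"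
      by (metis binomial_absorb_comp binomial_absorption mult.commute)
    then show ?thesis using True by (metis of_nat_diff of_nat_mult)
  qed (simp add: binomial_eq_0)
  have "(\<Sum>k\<le>N. binomial_coeff c (Suc i) k * int (a choose k))
      = (\<Sum>k\<le>N. (int k - c i) * binomial_coeff c i k * int (a choose k))
        + (\<Sum>k\<le>M. binomial_coeff c i k * (int (Suc k) * int (a choose Suc k)))"
    unfolding N
    by (simp add: sum.atMost_Suc_shift algebra_simps flip: sum.distrib del: sum.atMost_Suc binomial_Suc_Suc)
  also have "(\<Sum>k\<le>N. (int k - c i) * binomial_coeff c i k * int (a choose k))
      = (\<Sum>k\<le>M. (int k - c i) * binomial_coeff c i k * int (a choose k))"
    using M by (simp add: N binomial_coeff_eq_0)
  also have "\<dots> + (\<Sum>k\<le>M. binomial_coeff c i k * (int (Suc k) * int (a choose Suc k)))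
      = (int a - c i) * (\<Sum>k\<le>M. binomial_coeff c i k * int (a choose k))"
    unfolding absorb by (simp add: algebra_simps sum_distrib_left sum_subtractf sum.distrib)
  also have "\<dots> = (\<Prod>l<Suc i. int a - c l)"
    using Suc.IH[OF M] by simp
  finally show ?case by simp
qed

section \<open>Nonvanishing of minors of the Fourier matrix\<close>

lemma root_of_unity_eq_power:
  assumes "n > 0" and "z ^ n = 1"
  obtains b where "b < n" and "z = cis (2 * pi / real n) ^ b"
proof -
  have "z \<in> (\<lambda>k. cis (2 * pi * real k / real n)) ` {..<n}"
    using bij_betw_roots_unity[OF assms(1)] assms(2) by (auto simp: bij_betw_def)
  then obtain b where "b < n" "z = cis (2 * pi * real b / real n)" by auto
  then show thesis by (intro that[of b]) (simp_all add: DeMoivre mult_ac)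
qed

text \<open>Stated for sparse polynomials: were all sums zero, a square system with coefficients in
  the integer polynomials at a primitive root \<open>w\<close> would be singular. Its determinant,
  moved from \<open>w\<close> to 1, would be divisible by \<open>p\<close>, although it is a product
  of differences of distinct exponents below \<open>p\<close>.\<close>

theorem chebotarev_roots_of_unity:
  fixes c :: "nat \<Rightarrow> complex"
  assumes p: "prime p" and A: "A \<subseteq> {..<p}" and nz: "\<exists>a\<in>A. c a \<noteq> 0"
    and R: "R \<subseteq> {z. z ^ p = 1}" and card: "card A \<le> card R"
  shows "\<exists>z\<in>R. (\<Sum>a\<in>A. c a * z ^ a) \<noteq> 0"
proof (rule ccontr)
  assume "\<not> ?thesis"
  then have vanish: "(\<Sum>a\<in>A. c a * z ^ a) = 0" if "z \<in> R" for z using that by blast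
  define n where "n = card A"
  define w where "w = cis (2 * pi / real p)"
  have p0: "p > 0" using p by (rule prime_gt_0_nat)
  have w: "w ^ p = 1" using p0 by (simp add: w_def DeMoivre)
  have finA: "finite A" using A finite_subset by blast
  have np: "n \<le> p" using card_mono[OF _ A] by (simp add: n_def)
  obtain \<alpha> where \<alpha>: "bij_betw \<alpha> {..<n} A"
    using ex_bij_betw_nat_finite[OF finA] by (auto simp: n_def lessThan_atLeast0)
  have \<alpha>A: "\<alpha> j \<in> A" if "j < n" for j using \<alpha> that by (auto simp: bij_betw_def)
  have \<alpha>p: "\<alpha> j < p" if "j < n" for j using \<alpha>A[OF that] A by auto
  obtain R' where R': "R' \<subseteq> R" "card R' = n" "finite R'"
    using obtain_subset_with_card_n[OF card] by (metis n_def)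
  obtain x where x: "bij_betw x {..<n} R'"
    using ex_bij_betw_nat_finite[OF R'(3)] R'(2) by (auto simp: lessThan_atLeast0)
  have xR: "x l \<in> R" if "l < n" for l using x that R' by (auto simp: bij_betw_def)
  have "\<exists>b. x l = w ^ b" if "l < n" for l
  proof -
    have "x l ^ p = 1" using xR[OF that] R by auto
    then show ?thesis by (rule root_of_unity_eq_power[OF p0]) (auto simp: w_def)
  qed
  then obtain b where b: "\<And>l. l < n \<Longrightarrow> x l = w ^ b l" by metis
  have sumA: "(\<Sum>j<n. c (\<alpha> j) * z ^ \<alpha> j) = (\<Sum>a\<in>A. c a * z ^ a)" for z
    by (rule sum.reindex_bij_betw[OF \<alpha>])
  define y where "y = (\<lambda>l. w ^ b l)"
  \<comment> \<open>\<open>G k\<close> is the \<open>k\<close>-th divided difference, at the nodes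
    \<open>y\<close>, of the sparse polynomial with coefficients \<open>c\<close>. The polynomial
    vanishes at the distinct nodes \<open>y 0, ..., y (n - 1)\<close>, hence so do these
    differences.\<close>
  define G where "G = (\<lambda>k. \<Sum>j<n. c (\<alpha> j) * newton_coeff y (\<alpha> j) k)"
  have G: "G k = 0" if "k < n" for k
    using that
  proof (induction k rule: less_induct)
    case (less k)
    define P where "P = (\<lambda>m. \<Prod>l<m. y k - y l)"
    have "0 = (\<Sum>j<n. c (\<alpha> j) * y k ^ \<alpha> j)"
      unfolding sumA using vanish[OF xR[OF less.prems]] b[OF less.prems] by (simp add: y_def)
    also have "\<dots> = (\<Sum>j<n. c (\<alpha> j) * (\<Sum>m\<le>p. newton_coeff y (\<alpha> j) m * P m))"
    proof (intro sum.cong refl arg_cong2[where f = "(*)"])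
      fix j assume "j \<in> {..<n}"
      then have "\<alpha> j \<le> p" using \<alpha>p by (simp add: less_imp_le)
      then show "y k ^ \<alpha> j = (\<Sum>m\<le>p. newton_coeff y (\<alpha> j) m * P m)"
        unfolding P_def by (rule power_eq_newton_sum)
    qed
    also have "\<dots> = (\<Sum>m\<le>p. G m * P m)"
      unfolding G_def sum_distrib_left sum_distrib_right by (subst sum.swap) (simp add: mult_ac)
    \<comment> \<open>For \<open>m < k\<close> the induction hypothesis removes \<open>G m\<close>;
      for \<open>m > k\<close> the product \<open>P m\<close> contains the factor
      \<open>y k - y k\<close>. Only \<open>m = k\<close> survives.\<close>
    also have "\<dots> = (\<Sum>m\<in>{k}. G m * P m)"
    proof (rule sum.mono_neutral_right)
      show "\<forall>m\<in>{..p} - {k}. G m * P m = 0"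
      proof
        fix m assume m: "m \<in> {..p} - {k}"
        show "G m * P m = 0"
        proof (cases "m < k")
          case True
          then show ?thesis using less by simp
        next
          case False
          then have "k \<in> {..<m}" using m by auto
          then have "P m = 0" unfolding P_def by (intro prod_zero) auto
          then show ?thesis by simp
        qed
      qed
    qed (use less.prems np in auto)
    finally have "G k * P k = 0" by simp
    moreover have "P k \<noteq> 0"
    proof
      assume "P k = 0"
      then obtain l where l: "l < k" "y k = y l" by (auto simp: P_def)
      then have "x k = x l" using less.prems by (simp add: b y_def)
      then have "k = l"
        using x l less.prems by (auto simp: bij_betw_def dest: inj_onD)
      with l show False by simp
    qed
    ultimately show ?case by simp
  qed
  txt \<open>Combining the vanishing sums \<open>G k\<close> with Newton coefficients gives a matrix over the integer
    polynomials that is singular at \<open>w\<close>, but triangular with diagonal prime to \<open>p\<close> at \<open>1\<close>.\<close>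
  define X where "X = (\<lambda>l. monom (1 :: int) (b l))"
  define a where "a = (\<lambda>l. int (\<alpha> l))"
  define M where "M = mat n n (\<lambda>(i, j). \<Sum>k<n. of_int (binomial_coeff a i k) * newton_coeff X (\<alpha> j) k)"
  have M: "M \<in> carrier_mat n n" by (simp add: M_def)
  interpret ev: comm_ring_hom "\<lambda>g. ipoly g w" by (rule ipoly_hom)
  have XY: "(\<lambda>l. ipoly (X l) w) = y" by (simp add: X_def y_def map_poly_monom poly_monom fun_eq_iff)
  have X1: "(\<lambda>l. poly (X l) 1) = (\<lambda>_. 1)" by (simp add: X_def poly_monom fun_eq_iff)
  have Mw: "ipoly (M $$ (i, j)) w = (\<Sum>k<n. of_int (binomial_coeff a i k) * newton_coeff y (\<alpha> j) k)"
    if "i < n" "j < n" for i j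
    using that by (simp only: M_def index_mat prod.case ev.hom_sum ev.hom_mult ev.hom_newton_coeff ev.hom_of_int XY)
  \<comment> \<open>At 1 the Newton coefficients become binomial coefficients, so row
    \<open>i\<close> evaluates at \<open>a j\<close> the monic polynomial with roots
    \<open>a 0, ..., a (i - 1)\<close>; for \<open>j < i\<close> the value is 0.\<close>
  have M1: "poly (M $$ (i, j)) 1 = (\<Prod>l<i. a j - a l)" if ij: "i < n" "j < n" for i j
  proof -
    have n: "{..<n} = {..n - 1}" using ij by auto
    have "poly (M $$ (i, j)) 1 = (\<Sum>k<n. binomial_coeff a i k * int (\<alpha> j choose k))"
      using ij by (simp add: M_def poly_sum poly_hom.hom_newton_coeff X1 newton_coeff_const_1)
    also have "\<dots> = (\<Prod>l<i. int (\<alpha> j) - a l)"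
      unfolding n by (rule prod_eq_binomial_sum[symmetric]) (use ij in auto)
    finally show ?thesis by (simp add: a_def)
  qed
  have Mw': "map_mat (\<lambda>g. ipoly g w) M \<in> carrier_mat n n" using M by simp
  define v where "v = vec n (\<lambda>j. c (\<alpha> j))"
  obtain j0 where j0: "j0 < n" "c (\<alpha> j0) \<noteq> 0"
    using nz \<alpha> by (auto simp: bij_betw_def)
  have "det (map_mat (\<lambda>g. ipoly g w) M) = 0"
    unfolding det_0_iff_vec_prod_zero[OF Mw']
  proof (intro exI conjI)
    show "v \<in> carrier_vec n" by (simp add: v_def)
    show "v \<noteq> 0\<^sub>v n" using j0 by (auto simp: v_def vec_eq_iff)
    show "map_mat (\<lambda>g. ipoly g w) M *\<^sub>v v = 0\<^sub>v n"
    proof (rule eq_vecI)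
      fix i assume "i < dim_vec (0\<^sub>v n)"
      then have i: "i < n" by simp
      have "(map_mat (\<lambda>g. ipoly g w) M *\<^sub>v v) $ i = (\<Sum>j<n. ipoly (M $$ (i, j)) w * c (\<alpha> j))"
        using i M by (simp add: scalar_prod_def v_def lessThan_atLeast0)
      also have "\<dots> = (\<Sum>j<n. (\<Sum>k<n. of_int (binomial_coeff a i k) * newton_coeff y (\<alpha> j) k) * c (\<alpha> j))"
        using i by (intro sum.cong refl) (simp add: Mw)
      also have "\<dots> = (\<Sum>k<n. of_int (binomial_coeff a i k) * G k)"
        unfolding G_def sum_distrib_left sum_distrib_right by (subst sum.swap) (simp add: mult_ac)
      also have "\<dots> = 0" by (simp add: G)
      finally show "(map_mat (\<lambda>g. ipoly g w) M *\<^sub>v v) $ i = 0\<^sub>v n $ i" using i by simp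
    qed (use M in auto)
  qed
  then have "ipoly (det M) w = 0" by simp
  then have dvd: "int p dvd poly (det M) 1"
    by (rule prime_dvd_poly_1_if_root_of_unity[OF p w])
  have M1': "map_mat (\<lambda>g. poly g 1) M \<in> carrier_mat n n" using M by simp
  have ut: "upper_triangular (map_mat (\<lambda>g. poly g 1) M)"
    unfolding upper_triangular_def
  proof (intro allI impI)
    fix i j assume "i < dim_row (map_mat (\<lambda>g. poly g 1) M)" "j < i"
    then have ij: "i < n" "j < i" "j < n" using M by auto
    then have "(\<Prod>l<i. a j - a l) = 0" by (intro prod_zero) auto
    then show "map_mat (\<lambda>g. poly g 1) M $$ (i, j) = 0" using ij M by (simp add: M1)
  qed
  have "poly (det M) 1 = det (map_mat (\<lambda>g. poly g 1) M)" 
    by (rule comm_ring_hom.hom_det[symmetric]) (unfold_locales, auto)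
  also have "\<dots> = prod_list (diag_mat (map_mat (\<lambda>g. poly g 1) M))"
    by (rule det_upper_triangular[OF ut M1'])
  also have "\<dots> = (\<Prod>i<n. \<Prod>l<i. a i - a l)"
    using M by (simp add: prod_list_diag_prod M1 lessThan_atLeast0)
  finally have "int p dvd (\<Prod>i<n. \<Prod>l<i. a i - a l)" using dvd by simp
  then obtain i l where il: "i < n" "l < i" "int p dvd a i - a l"
    using p by (auto simp: prime_dvd_prod_iff)
  then have l: "l < n" by simp
  \<comment> \<open>Two exponents in \<open>{..<p}\<close> can be congruent modulo \<open>p\<close>
    only if they are equal.\<close>
  have "\<bar>a i - a l\<bar> < int p" using \<alpha>p[OF il(1)] \<alpha>p[OF l] by (auto simp: a_def)
  then have "a i = a l" using il(3) dvd_imp_le_int[of "a i - a l" "int p"] by force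
  then have "i = l" using \<alpha> il l by (auto simp: a_def bij_betw_def dest: inj_onD)
  then show False using il by simp
qed

subsection \<open>Characters and uncertainty on cyclic groups of prime order\<close>

text \<open>The parameter is the value at the generator 1, not an exponent, so that the Fourier
  transform becomes the evaluation of a polynomial at \<open>inverse z\<close>. For
  \<open>n > 1\<close> this is a character when \<open>z ^ n = 1\<close>.\<close>

definition root_char :: "nat \<Rightarrow> complex \<Rightarrow> int \<Rightarrow> complex"
  where "root_char n z = (\<lambda>x\<in>carrier (Z n). z ^ nat x)"

lemma carrier_Z: "n > 0 \<Longrightarrow> carrier (Z n) = {0..<int n}"
  by (simp add: carrier_integer_mod_group)

text \<open>A character is determined by its value at 1, and the \<open>n\<close>-th power of that
  value is the value at 0. The bound \<open>n > 1\<close> puts 1 into the carrier.\<close>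

lemma bij_betw_root_char:
  assumes n: "n > 1"
  shows "bij_betw (root_char n) {z. z ^ n = 1} (carrier (dual_group (Z n)))"
proof -
  have car: "carrier (Z n) = {0..<int n}" using n by (simp add: carrier_Z)
  have one: "1 \<in> carrier (Z n)" using n by (simp add: car)
  have ch: "root_char n z \<in> carrier (dual_group (Z n))" if z: "z ^ n = 1" for z
  proof -
    have "cmod z ^ n = 1 ^ n" using z by (simp flip: norm_power)
    then have "cmod z = 1" by (rule power_eq_imp_eq_base) (use n in auto)
    moreover have "z ^ nat ((x + y) mod int n) = z ^ nat x * z ^ nat y"
      if "0 \<le> x" "0 \<le> y" for x y
      using that by (simp add: nat_mod_distrib power_mod_root[OF z] nat_add_distrib power_add)
    ultimately show ?thesis
      by (auto simp: dual_group_def hom_def circle_group_def L_def root_char_def car norm_power)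
  qed
  have inj: "inj_on (root_char n) {z. z ^ n = 1}"
  proof (rule inj_onI)
    fix z z' assume "root_char n z = root_char n z'"
    then have "root_char n z 1 = root_char n z' 1" by simp
    then show "z = z'" using one by (simp add: root_char_def)
  qed
  have surj: "\<exists>z. z ^ n = 1 \<and> \<chi> = root_char n z" if chi: "\<chi> \<in> carrier (dual_group (Z n))" for \<chi>
  proof -
    from chi have ext: "\<chi> \<in> extensional (carrier (Z n))"
      and add: "\<And>x y. \<lbrakk>x \<in> carrier (Z n); y \<in> carrier (Z n)\<rbrakk> \<Longrightarrow> \<chi> ((x + y) mod int n) = \<chi> x * \<chi> y"
      and cmod: "\<And>x. x \<in> carrier (Z n) \<Longrightarrow> cmod (\<chi> x) = 1"
      by (auto simp: dual_group_def hom_def circle_group_def L_def PiE_def)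
    have "\<chi> 0 * \<chi> 0 = \<chi> 0" using add[of 0 0] n by (simp add: car)
    moreover have "\<chi> 0 \<noteq> 0" using cmod[of 0] n by (auto simp: car)
    ultimately have chi0: "\<chi> 0 = 1" by simp
    have pow: "\<chi> (int m mod int n) = \<chi> 1 ^ m" for m
    proof (induction m)
      case 0
      then show ?case by (simp add: chi0)
    next
      case (Suc m)
      have "\<chi> (int (Suc m) mod int n) = \<chi> ((int m mod int n + 1) mod int n)"
        by (simp add: mod_add_right_eq add.commute)
      also have "\<dots> = \<chi> (int m mod int n) * \<chi> 1"
        by (rule add) (use n one in \<open>auto simp: car\<close>)
      finally show ?case using Suc by simp
    qed
    have "\<chi> 1 ^ n = 1" using pow[of n] chi0 by simp
    moreover have "\<chi> = root_char n (\<chi> 1)"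
    proof (rule extensionalityI[OF ext])
      show "root_char n (\<chi> 1) \<in> extensional (carrier (Z n))" by (simp add: root_char_def)
      fix x assume x: "x \<in> carrier (Z n)"
      then show "\<chi> x = root_char n (\<chi> 1) x"
        using pow[of "nat x"] by (simp add: root_char_def car)
    qed
    ultimately show ?thesis by blast
  qed
  show ?thesis unfolding bij_betw_def using inj ch surj by auto
qed

lemma card_dual_Z: "n > 1 \<Longrightarrow> card (carrier (dual_group (Z n))) = n"
  using bij_betw_same_card[OF bij_betw_root_char] by (simp add: card_roots_unity_eq)

lemma finite_dual_Z: "n > 1 \<Longrightarrow> finite (carrier (dual_group (Z n)))"
  using card_dual_Z card_gt_0_iff by fastforce

lemma fourier_root_char:
  assumes n: "n > 1" and z: "z ^ n = 1"
  shows "fourier (Z n) f (root_char n z) = (\<Sum>a<n. f (int a) * inverse z ^ a)"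
proof -
  have car: "carrier (Z n) = {0..<int n}" using n by (simp add: carrier_Z)
  have ch: "root_char n z \<in> carrier (dual_group (Z n))"
    using bij_betw_root_char[OF n] z by (auto simp: bij_betw_def)
  have z0: "z \<noteq> 0" using z n by (auto simp: power_0_left)
  \<comment> \<open>The inverse of \<open>a\<close> in \<open>Z n\<close> is represented by
    \<open>(- a) mod n\<close>; reducing the exponent modulo \<open>n\<close> is harmless for a root
    of unity.\<close>
  have *: "z ^ nat ((- int a) mod int n) = inverse z ^ a" if "a < n" for a
  proof -
    have "z ^ nat ((- int a) mod int n) * z ^ a = z ^ (nat ((- int a) mod int n) + a)"
      by (simp add: power_add)
    also have "\<dots> = z ^ ((nat ((- int a) mod int n) + a) mod n)"
      by (simp add: power_mod_root[OF z])
    also have "(nat ((- int a) mod int n) + a) mod n = 0"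
    proof -
      have "int ((nat ((- int a) mod int n) + a) mod n) = ((- int a) mod int n + int a) mod int n"
        using n by (simp add: zmod_int)
      also have "\<dots> = 0" by (simp add: mod_add_left_eq)
      finally show ?thesis by simp
    qed
    finally show ?thesis using z0 by (simp add: field_simps)
  qed
  have "fourier (Z n) f (root_char n z) = (\<Sum>x\<in>{0..<int n}. f x * z ^ nat ((- x) mod int n))"
    using n ch by (auto simp: fourier_def root_char_def car intro!: sum.cong)
  also have "\<dots> = (\<Sum>a<n. f (int a) * z ^ nat ((- int a) mod int n))"
    by (rule sum.reindex_bij_witness[of _ int nat]) auto
  finally show ?thesis by (simp add: *)
qed

text \<open>The transform is a polynomial with \<open>card (supp (Z p) f)\<close> terms evaluated at
  the \<open>p\<close>-th roots of unity. By Chebotarev's theorem it has fewer zeros there than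
  terms.\<close>

theorem uncertainty_Z:
  assumes p: "prime p" and nz: "\<exists>x\<in>carrier (Z p). f x \<noteq> 0"
  shows "p + 1 \<le> card (supp (Z p) f) + card (fourier_supp (Z p) f)"
proof -
  have p1: "p > 1" using p by (rule prime_gt_1_nat)
  have car: "carrier (Z p) = {0..<int p}" using p1 by (simp add: carrier_Z)
  define A where "A = {a. a < p \<and> f (int a) \<noteq> 0}"
  define R where "R = {z::complex. z ^ p = 1}"
  \<comment> \<open>The transform at \<open>root_char p z\<close> evaluates at
    \<open>inverse z\<close>, so \<open>S\<close> corresponds to the Fourier support through
    inversion.\<close>
  define S where "S = {z\<in>R. (\<Sum>a\<in>A. f (int a) * z ^ a) \<noteq> 0}"
  have finR: "finite R" using p1 by (simp add: R_def finite_roots_unity)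
  have "bij_betw int A (supp (Z p) f)"
    by (rule bij_betwI[of _ _ _ nat]) (auto simp: A_def supp_def car)
  then have A: "card (supp (Z p) f) = card A" by (rule bij_betw_same_card[symmetric])
  have rc: "fourier (Z p) f (root_char p z) = (\<Sum>a\<in>A. f (int a) * inverse z ^ a)" if "z \<in> R" for z
    using that fourier_root_char[OF p1, of z f]
    by (simp add: R_def A_def) (intro sum.mono_neutral_right, auto)
  have "bij_betw (\<lambda>z. root_char p (inverse z)) S (fourier_supp (Z p) f)"
  proof (rule bij_betw_trans[of inverse S "inverse ` S" "root_char p", unfolded comp_def])
    show "bij_betw inverse S (inverse ` S)" by (simp add: bij_betw_def inj_on_def)
    have "bij_betw (root_char p) (inverse ` S) (root_char p ` (inverse ` S))"
      by (rule bij_betw_subset[OF bij_betw_root_char[OF p1]])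
         (auto simp: S_def R_def power_inverse)
    also have "root_char p ` (inverse ` S) = fourier_supp (Z p) f"
    proof (intro equalityI subsetI)
      fix \<chi> assume "\<chi> \<in> root_char p ` (inverse ` S)"
      then obtain z where z: "z \<in> S" "\<chi> = root_char p (inverse z)" by auto
      then have zi: "inverse z \<in> R" by (auto simp: S_def R_def power_inverse)
      then have "\<chi> \<in> carrier (dual_group (Z p))"
        using z bij_betw_root_char[OF p1] by (auto simp: bij_betw_def R_def)
      then show "\<chi> \<in> fourier_supp (Z p) f"
        using z rc[OF zi] by (simp add: supp_def S_def)
    next
      fix \<chi> assume chi: "\<chi> \<in> fourier_supp (Z p) f"
      then obtain z where z: "z \<in> R" "\<chi> = root_char p z"
        using bij_betw_root_char[OF p1] by (auto simp: bij_betw_def R_def supp_def)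
      then have "inverse z \<in> S" using chi rc[OF z(1)] by (auto simp: S_def supp_def R_def power_inverse)
      then show "\<chi> \<in> root_char p ` (inverse ` S)" using z by force
    qed
    finally show "bij_betw (root_char p) (inverse ` S) (fourier_supp (Z p) f)" .
  qed
  then have S: "card (fourier_supp (Z p) f) = card S" by (rule bij_betw_same_card[symmetric])
  have cardR: "card R = p" using p1 by (simp add: R_def card_roots_unity_eq)
  have "\<not> card A \<le> card (R - S)"
  proof
    assume "card A \<le> card (R - S)"
    moreover have "\<exists>a\<in>A. f (int a) \<noteq> 0"
    proof -
      obtain x where "x \<in> carrier (Z p)" "f x \<noteq> 0" using nz by blast
      then have "nat x \<in> A" "f (int (nat x)) \<noteq> 0" by (auto simp: A_def car)
      then show ?thesis by blast
    qed
    ultimately have "\<exists>z\<in>R - S. (\<Sum>a\<in>A. f (int a) * z ^ a) \<noteq> 0"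
      by (intro chebotarev_roots_of_unity[OF p]) (auto simp: A_def R_def)
    then show False by (auto simp: S_def)
  qed
  moreover have "card (R - S) = p - card S"
    using card_Diff_subset[of S R] finR cardR by (auto simp: S_def finite_subset)
  ultimately show ?thesis using A S by linarith
qed

text \<open>Degree \<open>s - 1\<close> leaves at most \<open>s\<close> coefficients, and
  \<open>s - 1\<close> prescribed zeros leave at most \<open>p - s + 1\<close> nonzero values. The
  uncertainty inequality then forces equality in both bounds.\<close>

theorem uncertainty_Z_sharp:
  assumes p: "prime p" and s: "1 \<le> s" "s \<le> p"
  obtains f where "f \<in> L (Z p)" "card (supp (Z p) f) = s" "card (fourier_supp (Z p) f) = p - s + 1"
proof -
  have p1: "p > 1" using p by (rule prime_gt_1_nat)
  have car: "carrier (Z p) = {0..<int p}" using p1 by (simp add: carrier_Z)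
  define R where "R = {z::complex. z ^ p = 1}"
  have finR: "finite R" using p1 by (simp add: R_def finite_roots_unity)
  have cardR: "card R = p" using p1 by (simp add: R_def card_roots_unity_eq)
  obtain S where S: "S \<subseteq> R" "card S = s - 1" "finite S"
    using obtain_subset_with_card_n[of "s - 1" R] s cardR by (metis diff_le_self le_trans)
  txt \<open>The coefficient sequence of a polynomial with \<open>s - 1\<close> roots of unity as its roots is extremal.\<close>
  define P where "P = (\<Prod>z\<in>S. [:- inverse z, 1:])"
  have "degree P = (\<Sum>z\<in>S. degree [:- inverse z, 1:])"
    unfolding P_def by (rule degree_prod_eq_sum_degree) auto
  then have deg: "degree P = s - 1" using S by simp
  have "P \<noteq> 0" unfolding P_def using S(3) by simp
  define f where "f = (\<lambda>x\<in>carrier (Z p). coeff P (nat x))"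
  have fL: "f \<in> L (Z p)" by (simp add: f_def L_def)
  have "s - 1 < p" using s by simp
  have "f (int (s - 1)) \<noteq> 0"
  proof -
    have "f (int (s - 1)) = lead_coeff P"
    proof -
      have "int (s - 1) \<in> {0..<int p}" using s by auto
      then show ?thesis unfolding deg by (simp only: f_def car restrict_apply' nat_int)
    qed
    then show ?thesis using \<open>P \<noteq> 0\<close> by simp
  qed
  then have nz: "\<exists>x\<in>carrier (Z p). f x \<noteq> 0" using s by (intro bexI[of _ "int (s - 1)"]) (auto simp: car)
  have "supp (Z p) f \<subseteq> int ` {..<s}"
  proof
    fix x assume "x \<in> supp (Z p) f"
    then have x: "0 \<le> x" "coeff P (nat x) \<noteq> 0" by (auto simp: supp_def f_def car split: if_splits)
    then have "nat x \<le> s - 1" using deg le_degree by metis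
    then show "x \<in> int ` {..<s}" using x s by (intro image_eqI[of _ _ "nat x"]) auto
  qed
  then have le1: "card (supp (Z p) f) \<le> s"
    using card_mono[of "int ` {..<s}"] by (simp add: card_image)
  have "fourier_supp (Z p) f \<subseteq> root_char p ` (R - S)"
  proof
    fix \<chi> assume chi: "\<chi> \<in> fourier_supp (Z p) f"
    then obtain z where z: "z \<in> R" "\<chi> = root_char p z"
      using bij_betw_root_char[OF p1] by (auto simp: bij_betw_def R_def supp_def)
    have "poly P (inverse z) = (\<Sum>a\<le>degree P. coeff P a * inverse z ^ a)" by (rule poly_altdef)
    also have "\<dots> = (\<Sum>a<p. coeff P a * inverse z ^ a)"
      using \<open>s - 1 < p\<close> deg by (intro sum.mono_neutral_left) (auto simp: coeff_eq_0)
    also have "\<dots> = fourier (Z p) f \<chi>"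
      using fourier_root_char[OF p1, of z f] z by (simp add: R_def f_def car)
    finally have "poly P (inverse z) \<noteq> 0" using chi by (simp add: supp_def)
    then have "z \<notin> S" using S(3) by (auto simp: P_def poly_prod)
    then show "\<chi> \<in> root_char p ` (R - S)" using z by auto
  qed
  then have "card (fourier_supp (Z p) f) \<le> card (R - S)"
    using finR by (meson card_image_le card_mono finite_Diff finite_imageI le_trans)
  also have "\<dots> = p - s + 1"
    using S finR cardR s by (simp add: card_Diff_subset)
  finally have "card (fourier_supp (Z p) f) \<le> p - s + 1" .
  with le1 uncertainty_Z[OF p nz] s have "card (supp (Z p) f) = s" "card (fourier_supp (Z p) f) = p - s + 1"
    by linarith+
  with fL show thesis by (rule that)
qed

subsection \<open>Fourier transform on direct products\<close>

lemma dual_groupD: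
  assumes "\<chi> \<in> carrier (dual_group G)"
  shows "\<chi> \<in> L G"
    and "\<And>x. x \<in> carrier G \<Longrightarrow> cmod (\<chi> x) = 1"
    and "\<And>x y. \<lbrakk>x \<in> carrier G; y \<in> carrier G\<rbrakk> \<Longrightarrow> \<chi> (x \<otimes>\<^bsub>G\<^esub> y) = \<chi> x * \<chi> y"
  using assms by (auto simp: dual_group_def hom_def circle_group_def)

lemma dual_groupI:
  assumes "\<chi> \<in> L G"
    and "\<And>x. x \<in> carrier G \<Longrightarrow> cmod (\<chi> x) = 1"
    and "\<And>x y. \<lbrakk>x \<in> carrier G; y \<in> carrier G\<rbrakk> \<Longrightarrow> \<chi> (x \<otimes>\<^bsub>G\<^esub> y) = \<chi> x * \<chi> y"
  shows "\<chi> \<in> carrier (dual_group G)"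
  using assms by (auto simp: dual_group_def hom_def circle_group_def)

lemma dual_group_nonzero: "\<lbrakk>\<chi> \<in> carrier (dual_group G); x \<in> carrier G\<rbrakk> \<Longrightarrow> \<chi> x \<noteq> 0"
  using dual_groupD(2)[of \<chi> G x] by auto

lemma dual_group_one:
  assumes "group G" and chi: "\<chi> \<in> carrier (dual_group G)"
  shows "\<chi> \<one>\<^bsub>G\<^esub> = 1"
proof -
  interpret group G by fact
  have "\<chi> \<one>\<^bsub>G\<^esub> * \<chi> \<one>\<^bsub>G\<^esub> = \<chi> \<one>\<^bsub>G\<^esub>"
    using dual_groupD(3)[OF chi one_closed one_closed] by simp
  then show ?thesis using dual_group_nonzero[OF chi one_closed] by simp
qed

lemma L_eqI: "\<lbrakk>f \<in> L G; g \<in> L G; \<And>x. x \<in> carrier G \<Longrightarrow> f x = g x\<rbrakk> \<Longrightarrow> f = g"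
  unfolding L_def by (rule PiE_ext)

lemma tensor_in_L: "tensor G H g h \<in> L (G \<times>\<times> H)"
  by (auto simp: tensor_def L_def)

lemma tensor_apply: "\<lbrakk>x \<in> carrier G; y \<in> carrier H\<rbrakk> \<Longrightarrow> tensor G H g h (x, y) = g x * h y"
  by (simp add: tensor_def)

lemma supp_tensor: "supp (G \<times>\<times> H) (tensor G H g h) = supp G g \<times> supp H h"
  by (auto simp: supp_def tensor_apply)

text \<open>The inverse map restricts a character to the two coordinate subgroups; it is an inverse
  because each \<open>(x, y)\<close> is the product of \<open>(x, 1)\<close> and
  \<open>(1, y)\<close>.\<close>

lemma bij_betw_tensor_dual:
  assumes G: "group G" and H: "group H"
  shows "bij_betw (\<lambda>(\<chi>, \<psi>). tensor G H \<chi> \<psi>)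
    (carrier (dual_group G) \<times> carrier (dual_group H)) (carrier (dual_group (G \<times>\<times> H)))"
proof -
  interpret G: group G by fact
  interpret H: group H by fact
  show ?thesis
  proof (rule bij_betwI[where g = "\<lambda>\<chi>. (\<lambda>x\<in>carrier G. \<chi> (x, \<one>\<^bsub>H\<^esub>), \<lambda>y\<in>carrier H. \<chi> (\<one>\<^bsub>G\<^esub>, y))"])
    show "(\<lambda>(\<chi>, \<psi>). tensor G H \<chi> \<psi>) \<in>
        carrier (dual_group G) \<times> carrier (dual_group H) \<rightarrow> carrier (dual_group (G \<times>\<times> H))"
      by (auto intro!: dual_groupI simp: tensor_in_L tensor_apply norm_mult dual_groupD)
    show "(\<lambda>\<chi>. (\<lambda>x\<in>carrier G. \<chi> (x, \<one>\<^bsub>H\<^esub>), \<lambda>y\<in>carrier H. \<chi> (\<one>\<^bsub>G\<^esub>, y))) \<in>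
        carrier (dual_group (G \<times>\<times> H)) \<rightarrow> carrier (dual_group G) \<times> carrier (dual_group H)"
    proof (rule Pi_I)
      fix \<chi> assume chi: "\<chi> \<in> carrier (dual_group (G \<times>\<times> H))"
      have "\<chi> (x \<otimes>\<^bsub>G\<^esub> y, \<one>\<^bsub>H\<^esub>) = \<chi> (x, \<one>\<^bsub>H\<^esub>) * \<chi> (y, \<one>\<^bsub>H\<^esub>)"
        if "x \<in> carrier G" "y \<in> carrier G" for x y
        using dual_groupD(3)[OF chi, of "(x, \<one>\<^bsub>H\<^esub>)" "(y, \<one>\<^bsub>H\<^esub>)"] that by simp
      moreover have "\<chi> (\<one>\<^bsub>G\<^esub>, x \<otimes>\<^bsub>H\<^esub> y) = \<chi> (\<one>\<^bsub>G\<^esub>, x) * \<chi> (\<one>\<^bsub>G\<^esub>, y)"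
        if "x \<in> carrier H" "y \<in> carrier H" for x y
        using dual_groupD(3)[OF chi, of "(\<one>\<^bsub>G\<^esub>, x)" "(\<one>\<^bsub>G\<^esub>, y)"] that by simp
      ultimately show "(\<lambda>x\<in>carrier G. \<chi> (x, \<one>\<^bsub>H\<^esub>), \<lambda>y\<in>carrier H. \<chi> (\<one>\<^bsub>G\<^esub>, y))
          \<in> carrier (dual_group G) \<times> carrier (dual_group H)"
        by (auto intro!: dual_groupI simp: L_def dual_groupD(2)[OF chi])
    qed
    fix \<chi>\<psi> assume "\<chi>\<psi> \<in> carrier (dual_group G) \<times> carrier (dual_group H)"
    then obtain \<chi> \<psi> where *: "\<chi>\<psi> = (\<chi>, \<psi>)"
      and chi: "\<chi> \<in> carrier (dual_group G)" and psi: "\<psi> \<in> carrier (dual_group H)" by auto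
    have "(\<lambda>x\<in>carrier G. tensor G H \<chi> \<psi> (x, \<one>\<^bsub>H\<^esub>)) = \<chi>"
      by (rule L_eqI[OF _ dual_groupD(1)[OF chi]])
         (auto simp: L_def tensor_apply dual_group_one[OF H psi])
    moreover have "(\<lambda>y\<in>carrier H. tensor G H \<chi> \<psi> (\<one>\<^bsub>G\<^esub>, y)) = \<psi>"
      by (rule L_eqI[OF _ dual_groupD(1)[OF psi]])
         (auto simp: L_def tensor_apply dual_group_one[OF G chi])
    ultimately show "(\<lambda>x\<in>carrier G. (case \<chi>\<psi> of (\<chi>, \<psi>) \<Rightarrow> tensor G H \<chi> \<psi>) (x, \<one>\<^bsub>H\<^esub>),
        \<lambda>y\<in>carrier H. (case \<chi>\<psi> of (\<chi>, \<psi>) \<Rightarrow> tensor G H \<chi> \<psi>) (\<one>\<^bsub>G\<^esub>, y)) = \<chi>\<psi>"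
      by (simp add: *)
  next
    fix \<chi> assume chi: "\<chi> \<in> carrier (dual_group (G \<times>\<times> H))"
    have "tensor G H (\<lambda>x\<in>carrier G. \<chi> (x, \<one>\<^bsub>H\<^esub>)) (\<lambda>y\<in>carrier H. \<chi> (\<one>\<^bsub>G\<^esub>, y)) = \<chi>"
    proof (rule L_eqI[OF tensor_in_L dual_groupD(1)[OF chi]])
      fix z assume "z \<in> carrier (G \<times>\<times> H)"
      then obtain x y where z: "z = (x, y)" "x \<in> carrier G" "y \<in> carrier H" by auto
      then show "tensor G H (\<lambda>x\<in>carrier G. \<chi> (x, \<one>\<^bsub>H\<^esub>)) (\<lambda>y\<in>carrier H. \<chi> (\<one>\<^bsub>G\<^esub>, y)) z = \<chi> z"
        using dual_groupD(3)[OF chi, of "(x, \<one>\<^bsub>H\<^esub>)" "(\<one>\<^bsub>G\<^esub>, y)"] by (simp add: tensor_apply)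
    qed
    then show "(case (\<lambda>x\<in>carrier G. \<chi> (x, \<one>\<^bsub>H\<^esub>), \<lambda>y\<in>carrier H. \<chi> (\<one>\<^bsub>G\<^esub>, y)) of
        (\<chi>, \<psi>) \<Rightarrow> tensor G H \<chi> \<psi>) = \<chi>" by simp
  qed
qed

lemma fourier_apply:
  "\<chi> \<in> carrier (dual_group G) \<Longrightarrow> fourier G f \<chi> = (\<Sum>x\<in>carrier G. f x * \<chi> (inv\<^bsub>G\<^esub> x))"
  by (simp add: fourier_def)

lemma fourier_zero:
  assumes "\<chi> \<in> carrier (dual_group G)" and "\<And>x. x \<in> carrier G \<Longrightarrow> f x = 0"
  shows "fourier G f \<chi> = 0"
  using assms by (simp add: fourier_apply)

text \<open>The transform on the product can be taken one variable at a time, which opens it to the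
  uncertainty principle on each factor.\<close>

lemma fourier_DirProd:
  assumes G: "group G" and H: "group H"
    and chi: "\<chi> \<in> carrier (dual_group G)" and psi: "\<psi> \<in> carrier (dual_group H)"
  shows "fourier (G \<times>\<times> H) f (tensor G H \<chi> \<psi>) =
    fourier G (\<lambda>x. fourier H (\<lambda>y. f (x, y)) \<psi>) \<chi>"
proof -
  have t: "tensor G H \<chi> \<psi> \<in> carrier (dual_group (G \<times>\<times> H))"
    using bij_betw_tensor_dual[OF G H] chi psi by (auto simp: bij_betw_def)
  have "fourier (G \<times>\<times> H) f (tensor G H \<chi> \<psi>) =
      (\<Sum>(x, y)\<in>carrier G \<times> carrier H. f (x, y) * \<psi> (inv\<^bsub>H\<^esub> y) * \<chi> (inv\<^bsub>G\<^esub> x))"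
    unfolding fourier_apply[OF t] using G H
    by (auto simp: tensor_apply group.inv_closed intro!: sum.cong)
  also have "\<dots> = (\<Sum>x\<in>carrier G. \<Sum>y\<in>carrier H. f (x, y) * \<psi> (inv\<^bsub>H\<^esub> y) * \<chi> (inv\<^bsub>G\<^esub> x))"
    by (rule sum.cartesian_product[symmetric])
  finally show ?thesis by (simp add: fourier_apply chi psi sum_distrib_right)
qed

lemma fourier_swap:
  assumes "\<chi> \<in> carrier (dual_group G)" and "\<psi> \<in> carrier (dual_group H)"
  shows "fourier G (\<lambda>x. fourier H (\<lambda>y. f x y) \<psi>) \<chi> = fourier H (\<lambda>y. fourier G (\<lambda>x. f x y) \<chi>) \<psi>"
proof -
  have "fourier G (\<lambda>x. fourier H (\<lambda>y. f x y) \<psi>) \<chi> =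
      (\<Sum>x\<in>carrier G. \<Sum>y\<in>carrier H. f x y * \<psi> (inv\<^bsub>H\<^esub> y) * \<chi> (inv\<^bsub>G\<^esub> x))"
    by (simp add: fourier_apply assms sum_distrib_right)
  also have "\<dots> = (\<Sum>y\<in>carrier H. \<Sum>x\<in>carrier G. f x y * \<psi> (inv\<^bsub>H\<^esub> y) * \<chi> (inv\<^bsub>G\<^esub> x))"
    by (rule sum.swap)
  also have "\<dots> = fourier H (\<lambda>y. fourier G (\<lambda>x. f x y) \<chi>) \<psi>"
    by (simp add: fourier_apply assms sum_distrib_right sum_distrib_left mult_ac)
  finally show ?thesis .
qed

text \<open>The Fourier support on the product, with pairs of characters in place of characters of
  the product and with \<open>f\<close> curried. In this form the two factors can be exchanged
  freely.\<close>

definition bi_fourier_supp :: "('a, 'c) monoid_scheme \<Rightarrow> ('b, 'd) monoid_scheme \<Rightarrow>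
    ('a \<Rightarrow> 'b \<Rightarrow> complex) \<Rightarrow> (('a \<Rightarrow> complex) \<times> ('b \<Rightarrow> complex)) set"
  where "bi_fourier_supp G H f = {(\<chi>, \<psi>) \<in> carrier (dual_group G) \<times> carrier (dual_group H).
    fourier G (\<lambda>x. fourier H (f x) \<psi>) \<chi> \<noteq> 0}"

lemma card_fourier_supp_DirProd:
  assumes G: "group G" and H: "group H"
  shows "card (fourier_supp (G \<times>\<times> H) f) = card (bi_fourier_supp G H (curry f))"
proof -
  let ?T = "\<lambda>(\<chi>, \<psi>). tensor G H \<chi> \<psi>"
  note bij = bij_betw_tensor_dual[OF G H]
  have "?T ` bi_fourier_supp G H (curry f) = fourier_supp (G \<times>\<times> H) f"
  proof (intro equalityI subsetI)
    fix \<chi> assume "\<chi> \<in> ?T ` bi_fourier_supp G H (curry f)"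
    then show "\<chi> \<in> fourier_supp (G \<times>\<times> H) f"
      using bij by (auto simp: bi_fourier_supp_def supp_def fourier_DirProd[OF G H] curry_def bij_betw_def)
  next
    fix \<chi> assume chi: "\<chi> \<in> fourier_supp (G \<times>\<times> H) f"
    then have "\<chi> \<in> ?T ` (carrier (dual_group G) \<times> carrier (dual_group H))"
      using bij by (auto simp: supp_def bij_betw_def)
    then show "\<chi> \<in> ?T ` bi_fourier_supp G H (curry f)"
      using chi by (force simp: bi_fourier_supp_def supp_def fourier_DirProd[OF G H] curry_def)
  qed
  moreover have "inj_on ?T (bi_fourier_supp G H (curry f))"
    by (rule inj_on_subset[OF bij_betw_imp_inj_on[OF bij]]) (auto simp: bi_fourier_supp_def)
  ultimately show ?thesis by (metis card_image)
qed

text \<open>This allows the bound proved for rows to be applied to columns with the same number of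
  frequencies.\<close>

lemma card_bi_fourier_supp_swap:
  "card (bi_fourier_supp H G (\<lambda>y x. f x y)) = card (bi_fourier_supp G H f)"
proof (rule bij_betw_same_card)
  have swap: "fourier H (\<lambda>y. fourier G (\<lambda>x. f x y) \<chi>) \<psi> = fourier G (\<lambda>x. fourier H (f x) \<psi>) \<chi>"
    if "\<chi> \<in> carrier (dual_group G)" "\<psi> \<in> carrier (dual_group H)" for \<chi> \<psi>
    using fourier_swap[OF that, of f] by simp
  show "bij_betw prod.swap (bi_fourier_supp H G (\<lambda>y x. f x y)) (bi_fourier_supp G H f)"
    by (rule bij_betwI[of _ _ _ prod.swap]) (auto simp: bi_fourier_supp_def swap)
qed

lemma card_fourier_supp_tensor:
  assumes G: "group G" and H: "group H"
  shows "card (fourier_supp (G \<times>\<times> H) (tensor G H g h)) =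
    card (fourier_supp G g) * card (fourier_supp H h)"
proof -
  have "fourier G (\<lambda>x. fourier H (\<lambda>y. tensor G H g h (x, y)) \<psi>) \<chi> = fourier G g \<chi> * fourier H h \<psi>"
    if chi: "\<chi> \<in> carrier (dual_group G)" and psi: "\<psi> \<in> carrier (dual_group H)" for \<chi> \<psi>
    by (simp add: fourier_apply chi psi tensor_apply sum_distrib_left sum_distrib_right mult_ac) (rule sum.swap)
  then have "bi_fourier_supp G H (curry (tensor G H g h)) = fourier_supp G g \<times> fourier_supp H h"
    by (auto simp: bi_fourier_supp_def supp_def curry_def)
  then show ?thesis by (simp add: card_fourier_supp_DirProd[OF G H] card_cartesian_product)
qed

section \<open>Characters and Dirac masses\<close>

text \<open>Orthogonality of characters: the transform is a geometric sum whose ratio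
  \<open>z / w\<close> is an \<open>n\<close>-th root of unity.\<close>

lemma fourier_supp_character_Z:
  assumes n: "n > 1" and psi: "\<psi> \<in> carrier (dual_group (Z n))" and chi: "\<chi> \<in> carrier (dual_group (Z n))"
  shows "fourier (Z n) \<psi> \<chi> = (if \<chi> = \<psi> then of_nat n else 0)"
proof -
  obtain z where z: "z ^ n = 1" "\<psi> = root_char n z"
    using psi bij_betw_root_char[OF n] by (auto simp: bij_betw_def)
  obtain w where w: "w ^ n = 1" "\<chi> = root_char n w"
    using chi bij_betw_root_char[OF n] by (auto simp: bij_betw_def)
  have eq: "\<chi> = \<psi> \<longleftrightarrow> w = z"
    using z w bij_betw_root_char[OF n] by (auto simp: bij_betw_def dest: inj_onD)
  have w0: "w \<noteq> 0" using w n by (auto simp: power_0_left)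
  have "fourier (Z n) \<psi> \<chi> = (\<Sum>a<n. \<psi> (int a) * inverse w ^ a)"
    unfolding w(2) by (rule fourier_root_char[OF n w(1)])
  also have "\<dots> = (\<Sum>a<n. (z / w) ^ a)"
    using n by (intro sum.cong refl) (simp add: z root_char_def carrier_Z power_divide power_inverse field_simps)
  also have "\<dots> = (if \<chi> = \<psi> then of_nat n else 0)"
  proof -
    have "(z / w) ^ n = 1" by (simp add: power_divide z w)
    then show ?thesis unfolding eq using w0 by (auto simp: sum_gp_strict)
  qed
  finally show ?thesis .
qed

lemma card_fourier_supp_character_Z:
  assumes "n > 1" and "\<psi> \<in> carrier (dual_group (Z n))"
  shows "card (fourier_supp (Z n) \<psi>) = 1"
proof -
  have "fourier_supp (Z n) \<psi> = {\<psi>}"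
    using assms by (auto simp: supp_def fourier_supp_character_Z split: if_splits)
  then show ?thesis by simp
qed

lemma card_supp_character_Z:
  assumes "n > 1" and "\<psi> \<in> carrier (dual_group (Z n))"
  shows "card (supp (Z n) \<psi>) = n"
proof -
  have "supp (Z n) \<psi> = carrier (Z n)"
    using dual_group_nonzero[OF assms(2)] by (auto simp: supp_def)
  then show ?thesis using assms(1) by (simp add: carrier_Z)
qed

text \<open>Subtract the multiple of \<open>\<psi>\<close> with the same Fourier coefficient. The
  difference has zero transform, so it vanishes: otherwise the uncertainty principle would require
  more than \<open>p\<close> points in its support. The factor is \<open>g 0\<close> because
  \<open>\<psi> 0 = 1\<close>.\<close>

lemma fourier_supp_singleton_Z:
  assumes p: "prime p" and sub: "fourier_supp (Z p) g \<subseteq> {\<psi>}"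
    and psi: "\<psi> \<in> carrier (dual_group (Z p))" and x: "x \<in> carrier (Z p)"
  shows "g x = g 0 * \<psi> x"
proof -
  have p1: "p > 1" using p by (rule prime_gt_1_nat)
  define c where "c = fourier (Z p) g \<psi> / of_nat p"
  define g' where "g' = (\<lambda>x. g x - c * \<psi> x)"
  have "fourier (Z p) g' \<chi> = 0" if chi: "\<chi> \<in> carrier (dual_group (Z p))" for \<chi>
  proof -
    have "fourier (Z p) g' \<chi> = fourier (Z p) g \<chi> - c * fourier (Z p) \<psi> \<chi>"
      using chi by (simp add: fourier_apply g'_def algebra_simps sum_subtractf sum_distrib_left)
    also have "\<dots> = 0"
      using sub chi p1 by (auto simp: fourier_supp_character_Z[OF p1 psi chi] c_def supp_def)
    finally show ?thesis .
  qed
  then have empty: "fourier_supp (Z p) g' = {}" by (auto simp: supp_def)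
  have "supp (Z p) g' \<subseteq> carrier (Z p)" by (auto simp: supp_def)
  then have "card (supp (Z p) g') \<le> p"
    using p1 card_mono[of "carrier (Z p)" "supp (Z p) g'"] by (simp add: carrier_Z)
  then have g: "g y = c * \<psi> y" if "y \<in> carrier (Z p)" for y
    using uncertainty_Z[OF p, of g'] empty that by (auto simp: g'_def)
  have "\<psi> 0 = 1" using dual_group_one[OF _ psi] by simp
  then show ?thesis using g[OF x] g[of 0] by simp
qed

lemma supp_translate_dirac:
  assumes G: "group G" and a: "a \<in> carrier G"
  shows "supp G (translate G a (dirac G)) = {a}"
proof -
  interpret group G by fact
  have "x \<otimes>\<^bsub>G\<^esub> inv\<^bsub>G\<^esub> a = \<one>\<^bsub>G\<^esub> \<longleftrightarrow> x = a" if "x \<in> carrier G" for x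
    using that a by (metis inv_closed inv_equality inv_inv r_inv)
  then show ?thesis using a by (auto simp: supp_def translate_def dirac_def)
qed

lemma translate_dirac_apply:
  assumes G: "group G" and a: "a \<in> carrier G" and x: "x \<in> carrier G"
  shows "translate G a (dirac G) x = (if x = a then 1 else 0)"
proof -
  interpret group G by fact
  have "x \<otimes>\<^bsub>G\<^esub> inv\<^bsub>G\<^esub> a = \<one>\<^bsub>G\<^esub> \<longleftrightarrow> x = a"
    using x a by (metis inv_closed inv_equality inv_inv r_inv)
  then show ?thesis using a x by (simp add: translate_def dirac_def)
qed

lemma fourier_supp_translate_dirac:
  assumes G: "group G" and fin: "finite (carrier G)" and a: "a \<in> carrier G"
  shows "fourier_supp G (translate G a (dirac G)) = carrier (dual_group G)"
proof -
  interpret group G by fact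
  have "fourier G (translate G a (dirac G)) \<chi> = \<chi> (inv\<^bsub>G\<^esub> a)" if chi: "\<chi> \<in> carrier (dual_group G)" for \<chi>
  proof -
    have "fourier G (translate G a (dirac G)) \<chi> = (\<Sum>x\<in>carrier G. if x = a then \<chi> (inv\<^bsub>G\<^esub> x) else 0)"
      by (auto simp: fourier_apply[OF chi] translate_dirac_apply[OF G a] intro!: sum.cong)
    then show ?thesis using fin a by (simp add: sum.delta')
  qed
  then show ?thesis using dual_group_nonzero[OF _ inv_closed[OF a]] by (auto simp: supp_def)
qed

subsection \<open>Grid supports\<close>

lemma group_Z: "group (Z n)"
  by simp

lemma card_carrier_Z: "n > 0 \<Longrightarrow> card (carrier (Z n)) = n"
  by (simp add: carrier_Z)

lemma finite_carrier_Z: "n > 0 \<Longrightarrow> finite (carrier (Z n))"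
  by (simp add: carrier_Z)

text \<open>\<open>D\<close> is a sum over the nonzero columns \<open>\<psi>\<close> of the row-wise
  transform, each supported in \<open>X\<close>. If the bound is attained, there are exactly
  \<open>q - t + 1\<close> such columns and each is nonzero on all of \<open>X\<close>, so all rows
  in \<open>X\<close> share one Fourier support. \<open>X\<close> and \<open>D\<close> enter through
  equations so that rows and columns can be handled with a common \<open>D\<close>.\<close>

lemma bi_uncertainty_rows:
  fixes f :: "int \<Rightarrow> int \<Rightarrow> complex"
  assumes p: "prime p" and q: "prime q"
    and X_def: "X = {x \<in> carrier (Z p). \<exists>y\<in>carrier (Z q). f x y \<noteq> 0}" and X: "X \<noteq> {}"
    and D_def: "D = card (bi_fourier_supp (Z p) (Z q) f)"
  obtains t where "1 \<le> t" "t \<le> q"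
    and "card X * t \<le> card {(x, y) \<in> carrier (Z p) \<times> carrier (Z q). f x y \<noteq> 0}"
    and "(p - card X + 1) * (q - t + 1) \<le> D"
    and "\<forall>x\<in>X. t \<le> card (supp (Z q) (f x))"
    and "D = (p - card X + 1) * (q - t + 1) \<longrightarrow>
      (\<exists>\<Psi>. card \<Psi> = q - t + 1 \<and> (\<forall>x\<in>X. fourier_supp (Z q) (f x) = \<Psi>))"
proof -
  have p1: "p > 1" and q1: "q > 1" using prime_gt_1_nat p q by blast+
  have finp: "finite (carrier (Z p))" and finq: "finite (carrier (Z q))"
    using p1 q1 by (auto intro: finite_carrier_Z)
  have findp: "finite (carrier (dual_group (Z p)))" and findq: "finite (carrier (dual_group (Z q)))"
    using p1 q1 by (auto intro: finite_dual_Z)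
  have Xsub: "X \<subseteq> carrier (Z p)" by (auto simp: X_def)
  then have finX: "finite X" using finp finite_subset by blast
  have cardX: "card X \<le> p" using card_mono[OF finp Xsub] p1 by (simp add: card_carrier_Z)
  have rowsub: "supp (Z q) (f x) \<subseteq> carrier (Z q)" for x by (auto simp: supp_def)
  have finrow: "finite (supp (Z q) (f x))" for x using finq rowsub finite_subset by blast
  define t where "t = Min ((\<lambda>x. card (supp (Z q) (f x))) ` X)"
  have tle: "t \<le> card (supp (Z q) (f x))" if "x \<in> X" for x
    unfolding t_def by (rule Min_le) (use finX that in auto)
  have "t \<in> (\<lambda>x. card (supp (Z q) (f x))) ` X"
    unfolding t_def by (rule Min_in) (use finX X in auto)
  then obtain x0 where x0: "x0 \<in> X" "t = card (supp (Z q) (f x0))" by auto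
  have nz0: "\<exists>y\<in>carrier (Z q). f x0 y \<noteq> 0" using x0 by (auto simp: X_def)
  have t1: "1 \<le> t"
  proof -
    have "supp (Z q) (f x0) \<noteq> {}" using nz0 by (auto simp: supp_def)
    then have "card (supp (Z q) (f x0)) > 0" using finrow card_gt_0_iff by blast
    then show ?thesis using x0 by simp
  qed
  have tq: "t \<le> q" using card_mono[OF finq rowsub] q1 x0 by (simp add: card_carrier_Z)
  have "{(x, y) \<in> carrier (Z p) \<times> carrier (Z q). f x y \<noteq> 0} = Sigma X (\<lambda>x. supp (Z q) (f x))"
    by (auto simp: X_def supp_def)
  then have "card {(x, y) \<in> carrier (Z p) \<times> carrier (Z q). f x y \<noteq> 0} =
      (\<Sum>x\<in>X. card (supp (Z q) (f x)))"
    using finX finrow by simp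
  also have "\<dots> \<ge> (\<Sum>x\<in>X. t)" by (rule sum_mono) (rule tle)
  finally have S: "card X * t \<le> card {(x, y) \<in> carrier (Z p) \<times> carrier (Z q). f x y \<noteq> 0}"
    by simp
  define g where "g = (\<lambda>\<psi> x. fourier (Z q) (f x) \<psi>)"
  \<comment> \<open>These are the frequencies of the second factor whose column
    \<open>g \<psi>\<close> is not identically zero; only they contribute to
    \<open>D\<close>.\<close>
  define \<Psi> where "\<Psi> = {\<psi> \<in> carrier (dual_group (Z q)). \<exists>x\<in>carrier (Z p). g \<psi> x \<noteq> 0}"
  have g_apply: "fourier (Z q) (f x) \<psi> = g \<psi> x" for x \<psi>
    by (simp add: g_def)
  have fin\<Psi>: "finite \<Psi>" using findq by (simp add: \<Psi>_def)
  have gsupp: "supp (Z p) (g \<psi>) \<subseteq> X" if "\<psi> \<in> \<Psi>" for \<psi>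
  proof
    fix x assume x: "x \<in> supp (Z p) (g \<psi>)"
    then have "x \<in> carrier (Z p)" "fourier (Z q) (f x) \<psi> \<noteq> 0" by (auto simp: supp_def g_def)
    then show "x \<in> X" using fourier_zero[of \<psi> "Z q" "f x"] that by (auto simp: X_def \<Psi>_def)
  qed
  have gunc: "p + 1 \<le> card (supp (Z p) (g \<psi>)) + card (fourier_supp (Z p) (g \<psi>))" if "\<psi> \<in> \<Psi>" for \<psi>
    by (rule uncertainty_Z[OF p]) (use that in \<open>auto simp: \<Psi>_def\<close>)
  have glow: "p - card X + 1 \<le> card (fourier_supp (Z p) (g \<psi>))" if "\<psi> \<in> \<Psi>" for \<psi>
    using gunc[OF that] card_mono[OF finX gsupp[OF that]] cardX by linarith
  have finfs: "finite (fourier_supp (Z p) h)" for h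
    using findp by (auto simp: supp_def)
  have "bi_fourier_supp (Z p) (Z q) f = prod.swap ` Sigma \<Psi> (\<lambda>\<psi>. fourier_supp (Z p) (g \<psi>))"
  proof -
    have "\<psi> \<in> \<Psi>" if "\<psi> \<in> carrier (dual_group (Z q))" "\<chi> \<in> carrier (dual_group (Z p))"
      "fourier (Z p) (g \<psi>) \<chi> \<noteq> 0" for \<chi> \<psi>
      using that fourier_zero[of \<chi> "Z p" "g \<psi>"] by (auto simp: \<Psi>_def)
    then have "bi_fourier_supp (Z p) (Z q) f = {(\<chi>, \<psi>). \<psi> \<in> \<Psi> \<and> \<chi> \<in> fourier_supp (Z p) (g \<psi>)}"
      by (auto simp: bi_fourier_supp_def supp_def g_apply) (auto simp: \<Psi>_def)
    then show ?thesis by force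
  qed
  then have D: "D = (\<Sum>\<psi>\<in>\<Psi>. card (fourier_supp (Z p) (g \<psi>)))"
    using fin\<Psi> finfs by (simp add: D_def card_image)
  have fsub: "fourier_supp (Z q) (f x) \<subseteq> \<Psi>" if "x \<in> X" for x
    using that by (auto simp: \<Psi>_def supp_def g_def X_def)
  have "q + 1 \<le> t + card (fourier_supp (Z q) (f x0))"
    using uncertainty_Z[OF q nz0] x0 by simp
  then have \<Psi>low: "q - t + 1 \<le> card \<Psi>"
    using card_mono[OF fin\<Psi> fsub[OF x0(1)]] tq by linarith
  have Dlow: "card \<Psi> * (p - card X + 1) \<le> D"
    unfolding D using sum_mono[of \<Psi> "\<lambda>_. p - card X + 1", OF glow] by simp
  have low: "(p - card X + 1) * (q - t + 1) \<le> D"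
    using le_trans[OF mult_le_mono1[OF \<Psi>low] Dlow] by (subst mult.commute)
  have eq: "\<exists>\<Psi>. card \<Psi> = q - t + 1 \<and> (\<forall>x\<in>X. fourier_supp (Z q) (f x) = \<Psi>)"
    if Deq: "D = (p - card X + 1) * (q - t + 1)"
  proof -
    have "card \<Psi> * (p - card X + 1) \<le> (q - t + 1) * (p - card X + 1)"
      using Dlow unfolding Deq by (simp only: mult.commute)
    then have "card \<Psi> \<le> q - t + 1" by (simp only: mult_le_cancel2)
    then have c\<Psi>: "card \<Psi> = q - t + 1" using \<Psi>low by simp
    \<comment> \<open>A single column with a larger Fourier support would already push the sum above
      \<open>D\<close>.\<close>
    have tight: "card (fourier_supp (Z p) (g \<psi>)) = p - card X + 1" if "\<psi> \<in> \<Psi>" for \<psi>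
    proof (rule ccontr)
      assume "\<not> ?thesis"
      then have "p - card X + 1 < card (fourier_supp (Z p) (g \<psi>))" using glow[OF that] by simp
      then have "(\<Sum>\<psi>\<in>\<Psi>. p - card X + 1) < D"
        unfolding D using fin\<Psi> that glow by (intro sum_strict_mono_ex1) auto
      then show False unfolding Deq by (simp add: c\<Psi> mult.commute)
    qed
    \<comment> \<open>With the Fourier support of \<open>g \<psi>\<close> as small as possible, the
      uncertainty principle makes its support at least as large as \<open>X\<close>, which contains
      it.\<close>
    have full: "supp (Z p) (g \<psi>) = X" if "\<psi> \<in> \<Psi>" for \<psi>
      using gunc[OF that] tight[OF that] cardX card_subset_eq[OF finX gsupp[OF that]]
        card_mono[OF finX gsupp[OF that]] by linarith
    have "fourier_supp (Z q) (f x) = \<Psi>" if "x \<in> X" for x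
      using fsub[OF that] full that by (auto simp: supp_def g_def \<Psi>_def)
    then show ?thesis using c\<Psi> by blast
  qed
  show thesis
    by (rule that[OF t1 tq S low]) (use tle eq in blast)+
qed

text \<open>The objective \<open>F\<close> at integer points, kept in the natural numbers.
  Subtraction is truncated, so agreement with \<open>F\<close> is claimed only for
  \<open>s \<le> p\<close> and \<open>t \<le> q\<close>.\<close>

definition grid_value :: "nat \<Rightarrow> nat \<Rightarrow> nat \<Rightarrow> nat \<Rightarrow> nat"
  where "grid_value p q s t = (p - s + 1) * (q - t + 1)"

text \<open>Integer form of the condition defining \<open>\<MM>\<close>. The last clause is the
  uniqueness that later turns equal values into equal grid parameters.\<close>

definition unique_grid_min :: "nat \<Rightarrow> nat \<Rightarrow> nat \<Rightarrow> nat \<Rightarrow> nat \<Rightarrow> bool"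
  where "unique_grid_min p q k s0 t0 \<longleftrightarrow> 1 \<le> s0 \<and> s0 \<le> p \<and> 1 \<le> t0 \<and> t0 \<le> q \<and> s0 * t0 \<le> k \<and>
    (\<forall>s t. 1 \<le> s \<and> s \<le> p \<and> 1 \<le> t \<and> t \<le> q \<and> s * t \<le> k \<longrightarrow>
      grid_value p q s0 t0 \<le> grid_value p q s t \<and>
      (grid_value p q s t = grid_value p q s0 t0 \<longrightarrow> s = s0 \<and> t = t0))"

lemma supp_curry:
  "supp (G \<times>\<times> H) f = {(x, y) \<in> carrier G \<times> carrier H. curry f x y \<noteq> 0}"
  by (auto simp: supp_def)

text \<open>Rows and columns produce two admissible points, \<open>(card X, t)\<close> and
  \<open>(s, card Y)\<close>, whose values bound the Fourier support from below. If the minimum is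
  attained, uniqueness identifies both points with \<open>(s0, t0)\<close>.\<close>

lemma card_fourier_supp_ge_grid_min:
  assumes p: "prime p" and q: "prime q" and min: "unique_grid_min p q k s0 t0"
    and card: "card (supp (Z p \<times>\<times> Z q) f) \<le> k" and nz: "supp (Z p \<times>\<times> Z q) f \<noteq> {}"
  shows "grid_value p q s0 t0 \<le> card (fourier_supp (Z p \<times>\<times> Z q) f)"
    and "card (fourier_supp (Z p \<times>\<times> Z q) f) = grid_value p q s0 t0 \<Longrightarrow>
      \<exists>X Y. card X = s0 \<and> card Y = t0 \<and> X \<subseteq> carrier (Z p) \<and> Y \<subseteq> carrier (Z q) \<and>
        supp (Z p \<times>\<times> Z q) f = X \<times> Y \<and>
        (\<exists>\<Psi>. card \<Psi> = q - t0 + 1 \<and> (\<forall>x\<in>X. fourier_supp (Z q) (\<lambda>y. f (x, y)) = \<Psi>)) \<and>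
        (\<exists>\<Phi>. card \<Phi> = p - s0 + 1 \<and> (\<forall>y\<in>Y. fourier_supp (Z p) (\<lambda>x. f (x, y)) = \<Phi>))"
proof -
  let ?f = "curry f" and ?f' = "\<lambda>y x. curry f x y"
  have p1: "p > 1" and q1: "q > 1" using prime_gt_1_nat p q by blast+
  define X where "X = {x \<in> carrier (Z p). \<exists>y\<in>carrier (Z q). ?f x y \<noteq> 0}"
  define Y where "Y = {y \<in> carrier (Z q). \<exists>x\<in>carrier (Z p). ?f' y x \<noteq> 0}"
  have X: "X \<noteq> {}" and Y: "Y \<noteq> {}" using nz by (auto simp: X_def Y_def supp_curry)
  have finX: "finite X" and finY: "finite Y"
    using p1 q1 by (auto simp: X_def Y_def finite_carrier_Z)
  have cX: "1 \<le> card X" "card X \<le> p" and cY: "1 \<le> card Y" "card Y \<le> q"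
  proof -
    show "1 \<le> card X" "1 \<le> card Y" using X Y finX finY by (simp_all add: Suc_le_eq card_gt_0_iff)
    show "card X \<le> p" "card Y \<le> q"
      using p1 q1 card_mono[of "carrier (Z p)" X] card_mono[of "carrier (Z q)" Y]
      by (auto simp: X_def Y_def finite_carrier_Z card_carrier_Z)
  qed
  define D where "D = card (fourier_supp (Z p \<times>\<times> Z q) f)"
  have D1: "D = card (bi_fourier_supp (Z p) (Z q) ?f)"
    by (simp only: D_def card_fourier_supp_DirProd[OF group_Z group_Z])
  have D2: "D = card (bi_fourier_supp (Z q) (Z p) ?f')"
    unfolding D1 by (rule card_bi_fourier_supp_swap[symmetric])
  obtain t where t: "1 \<le> t" "t \<le> q"
      "card X * t \<le> card {(x, y) \<in> carrier (Z p) \<times> carrier (Z q). ?f x y \<noteq> 0}"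
      "(p - card X + 1) * (q - t + 1) \<le> D"
      "\<forall>x\<in>X. t \<le> card (supp (Z q) (?f x))"
      "D = (p - card X + 1) * (q - t + 1) \<longrightarrow>
        (\<exists>\<Psi>. card \<Psi> = q - t + 1 \<and> (\<forall>x\<in>X. fourier_supp (Z q) (?f x) = \<Psi>))"
    by (rule bi_uncertainty_rows[OF p q X_def X D1])
  obtain s where s: "1 \<le> s" "s \<le> p"
      "card Y * s \<le> card {(y, x) \<in> carrier (Z q) \<times> carrier (Z p). ?f' y x \<noteq> 0}"
      "(q - card Y + 1) * (p - s + 1) \<le> D"
      "\<forall>y\<in>Y. s \<le> card (supp (Z p) (?f' y))"
      "D = (q - card Y + 1) * (p - s + 1) \<longrightarrow>
        (\<exists>\<Phi>. card \<Phi> = p - s + 1 \<and> (\<forall>y\<in>Y. fourier_supp (Z p) (?f' y) = \<Phi>))"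
    by (rule bi_uncertainty_rows[OF q p Y_def Y D2])
  have "{(y, x) \<in> carrier (Z q) \<times> carrier (Z p). ?f' y x \<noteq> 0} = prod.swap ` supp (Z p \<times>\<times> Z q) f"
    by (auto simp: supp_def)
  then have swapcard: "card {(y, x) \<in> carrier (Z q) \<times> carrier (Z p). ?f' y x \<noteq> 0} \<le> k"
    using card by (simp add: card_image)
  have Xt: "card X * t \<le> k" using t(3) card unfolding supp_curry by linarith
  have sY: "s * card Y \<le> k" using s(3) swapcard by (simp only: mult.commute le_trans)
  have le1: "grid_value p q s0 t0 \<le> grid_value p q (card X) t"
    and eq1: "grid_value p q (card X) t = grid_value p q s0 t0 \<Longrightarrow> card X = s0 \<and> t = t0"
    using min cX t Xt unfolding unique_grid_min_def by blast+
  have le2: "grid_value p q s0 t0 \<le> grid_value p q s (card Y)"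
    and eq2: "grid_value p q s (card Y) = grid_value p q s0 t0 \<Longrightarrow> s = s0 \<and> card Y = t0"
    using min cY s sY unfolding unique_grid_min_def by blast+
  show "grid_value p q s0 t0 \<le> card (fourier_supp (Z p \<times>\<times> Z q) f)"
    using le1 t(4) by (simp add: grid_value_def D_def)
  assume "card (fourier_supp (Z p \<times>\<times> Z q) f) = grid_value p q s0 t0"
  then have Deq: "D = grid_value p q s0 t0" by (simp add: D_def)
  have g1: "grid_value p q (card X) t = grid_value p q s0 t0"
    using le1 t(4) Deq by (simp add: grid_value_def)
  have g2: "grid_value p q s (card Y) = grid_value p q s0 t0"
    using le2 s(4) Deq by (simp add: grid_value_def mult.commute)
  have Xs0: "card X = s0" and tt0: "t = t0" using eq1[OF g1] by auto
  have ss0: "s = s0" and Yt0: "card Y = t0" using eq2[OF g2] by auto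
  \<comment> \<open>A row in \<open>X\<close> has its support inside \<open>Y\<close> and has at
    least \<open>t = t0 = card Y\<close> nonzero entries.\<close>
  have row: "supp (Z q) (?f x) = Y" if x: "x \<in> X" for x
  proof (rule card_seteq[OF finY])
    show "supp (Z q) (?f x) \<subseteq> Y" using x by (auto simp: X_def Y_def supp_def)
    show "card Y \<le> card (supp (Z q) (?f x))" using t(5) x Yt0 tt0 by simp
  qed
  have "supp (Z p \<times>\<times> Z q) f = X \<times> Y"
    using row by (auto simp: supp_def X_def Y_def)
  moreover have "X \<subseteq> carrier (Z p)" "Y \<subseteq> carrier (Z q)" by (auto simp: X_def Y_def)
  moreover have "\<exists>\<Psi>. card \<Psi> = q - t0 + 1 \<and> (\<forall>x\<in>X. fourier_supp (Z q) (\<lambda>y. f (x, y)) = \<Psi>)"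
    using t(6) Deq g1 tt0 by (simp add: grid_value_def curry_def)
  moreover have "\<exists>\<Phi>. card \<Phi> = p - s0 + 1 \<and> (\<forall>y\<in>Y. fourier_supp (Z p) (\<lambda>x. f (x, y)) = \<Phi>)"
    using s(6) Deq g2 ss0 by (simp add: grid_value_def curry_def mult.commute)
  ultimately show "\<exists>X Y. card X = s0 \<and> card Y = t0 \<and> X \<subseteq> carrier (Z p) \<and> Y \<subseteq> carrier (Z q) \<and>
        supp (Z p \<times>\<times> Z q) f = X \<times> Y \<and>
        (\<exists>\<Psi>. card \<Psi> = q - t0 + 1 \<and> (\<forall>x\<in>X. fourier_supp (Z q) (\<lambda>y. f (x, y)) = \<Psi>)) \<and>
        (\<exists>\<Phi>. card \<Phi> = p - s0 + 1 \<and> (\<forall>y\<in>Y. fourier_supp (Z p) (\<lambda>x. f (x, y)) = \<Phi>))"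
    using Xs0 Yt0 by blast
qed

section \<open>The value of Meshulam's function and the shape of equality cases\<close>

lemma card_supp_DirProd_Z:
  "card (supp (Z p \<times>\<times> Z q) (tensor (Z p) (Z q) g h)) = card (supp (Z p) g) * card (supp (Z q) h)"
  by (simp add: supp_tensor card_cartesian_product)

text \<open>The lower bound is attained by the tensor product of extremal functions on the factors
  with supports of size \<open>s0\<close> and \<open>t0\<close>.\<close>

lemma theta_eq_grid_min:
  assumes p: "prime p" and q: "prime q" and min: "unique_grid_min p q k s0 t0"
  shows "\<theta> k (Z p \<times>\<times> Z q) = grid_value p q s0 t0"
  unfolding \<theta>_def
proof (rule Min_eqI)
  have p1: "p > 1" and q1: "q > 1" using prime_gt_1_nat p q by blast+
  let ?A = "{card (fourier_supp (Z p \<times>\<times> Z q) f) |f. f \<in> L (Z p \<times>\<times> Z q) \<and>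
    f \<noteq> (\<lambda>x\<in>carrier (Z p \<times>\<times> Z q). 0) \<and> card (supp (Z p \<times>\<times> Z q) f) \<le> k}"
  \<comment> \<open>\<open>Min\<close> is meaningful only on a finite set, so the Fourier supports
    have to be bounded uniformly.\<close>
  have fin: "finite (carrier (dual_group (Z p \<times>\<times> Z q)))"
    using bij_betw_finite[OF bij_betw_tensor_dual[OF group_Z group_Z, of p q]] p1 q1
    by (simp add: finite_dual_Z)
  have "card (fourier_supp (Z p \<times>\<times> Z q) f) \<le> card (carrier (dual_group (Z p \<times>\<times> Z q)))" for f
    by (rule card_mono[OF fin]) (auto simp: supp_def)
  then have "?A \<subseteq> {..card (carrier (dual_group (Z p \<times>\<times> Z q)))}" by auto
  then show "finite ?A" using finite_subset by blast
  show "grid_value p q s0 t0 \<le> n" if "n \<in> ?A" for n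
  proof -
    from that obtain f where f: "f \<in> L (Z p \<times>\<times> Z q)" "f \<noteq> (\<lambda>x\<in>carrier (Z p \<times>\<times> Z q). 0)"
      "card (supp (Z p \<times>\<times> Z q) f) \<le> k" "n = card (fourier_supp (Z p \<times>\<times> Z q) f)" by blast
    have "supp (Z p \<times>\<times> Z q) f \<noteq> {}"
    proof
      assume "supp (Z p \<times>\<times> Z q) f = {}"
      then have "f = (\<lambda>x\<in>carrier (Z p \<times>\<times> Z q). 0)"
        by (intro L_eqI[OF f(1)]) (auto simp: L_def supp_def)
      with f(2) show False by simp
    qed
    then show ?thesis unfolding f(4) by (rule card_fourier_supp_ge_grid_min(1)[OF p q min f(3)])
  qed
  have m: "1 \<le> s0" "s0 \<le> p" "1 \<le> t0" "t0 \<le> q" "s0 * t0 \<le> k"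
    using min by (auto simp: unique_grid_min_def)
  obtain g where g: "card (supp (Z p) g) = s0" "card (fourier_supp (Z p) g) = p - s0 + 1"
    using uncertainty_Z_sharp[OF p m(1,2)] by metis
  obtain h where h: "card (supp (Z q) h) = t0" "card (fourier_supp (Z q) h) = q - t0 + 1"
    using uncertainty_Z_sharp[OF q m(3,4)] by metis
  let ?f = "tensor (Z p) (Z q) g h"
  have c: "card (supp (Z p \<times>\<times> Z q) ?f) = s0 * t0" by (simp add: card_supp_DirProd_Z g h)
  have "?f \<noteq> (\<lambda>x\<in>carrier (Z p \<times>\<times> Z q). 0)"
  proof
    assume "?f = (\<lambda>x\<in>carrier (Z p \<times>\<times> Z q). 0)"
    then have "supp (Z p \<times>\<times> Z q) ?f = {}" by (simp add: supp_def)
    then show False using c m by simp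
  qed
  moreover have "card (fourier_supp (Z p \<times>\<times> Z q) ?f) = grid_value p q s0 t0"
    by (simp add: card_fourier_supp_tensor[OF group_Z group_Z] g h grid_value_def)
  ultimately show "grid_value p q s0 t0 \<in> ?A"
    using c m(5) tensor_in_L[of "Z p" "Z q" g h] by (intro CollectI exI[of _ ?f]) auto
qed

text \<open>An equality case has exactly \<open>k\<close> nonzero values, so the grid shape of its
  support forces \<open>k = s0 * t0\<close>. All divisibility conditions come from here.\<close>

lemma equality_cases_structure:
  assumes p: "prime p" and q: "prime q" and min: "unique_grid_min p q k s0 t0"
    and f: "f \<in> equality_cases k (Z p \<times>\<times> Z q)"
  obtains X Y \<Psi> \<Phi> where "f \<in> L (Z p \<times>\<times> Z q)"
    and "card (fourier_supp (Z p \<times>\<times> Z q) f) = grid_value p q s0 t0"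
    and "card X = s0" "card Y = t0" "X \<subseteq> carrier (Z p)" "Y \<subseteq> carrier (Z q)"
    and "supp (Z p \<times>\<times> Z q) f = X \<times> Y" "k = s0 * t0"
    and "card \<Psi> = q - t0 + 1" "\<forall>x\<in>X. fourier_supp (Z q) (\<lambda>y. f (x, y)) = \<Psi>"
    and "card \<Phi> = p - s0 + 1" "\<forall>y\<in>Y. fourier_supp (Z p) (\<lambda>x. f (x, y)) = \<Phi>"
proof -
  have fL: "f \<in> L (Z p \<times>\<times> Z q)" and k: "card (supp (Z p \<times>\<times> Z q) f) = k"
    and d: "card (fourier_supp (Z p \<times>\<times> Z q) f) = grid_value p q s0 t0"
    using f theta_eq_grid_min[OF p q min] by (auto simp: equality_cases_def)
  have "1 \<le> s0 * t0" "s0 * t0 \<le> k" using min by (auto simp: unique_grid_min_def)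
  then have "supp (Z p \<times>\<times> Z q) f \<noteq> {}" using k by auto
  then obtain X Y where XY: "card X = s0" "card Y = t0" "X \<subseteq> carrier (Z p)" "Y \<subseteq> carrier (Z q)"
      "supp (Z p \<times>\<times> Z q) f = X \<times> Y"
      "\<exists>\<Psi>. card \<Psi> = q - t0 + 1 \<and> (\<forall>x\<in>X. fourier_supp (Z q) (\<lambda>y. f (x, y)) = \<Psi>)"
      "\<exists>\<Phi>. card \<Phi> = p - s0 + 1 \<and> (\<forall>y\<in>Y. fourier_supp (Z p) (\<lambda>x. f (x, y)) = \<Phi>)"
    using card_fourier_supp_ge_grid_min(2)[OF p q min _ _ d] k by (metis order_refl)
  moreover have "k = s0 * t0" using k XY by (simp add: card_cartesian_product)
  ultimately show thesis using fL d that by metis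
qed

lemma tensor_in_equality_cases:
  assumes p: "prime p" and q: "prime q" and min: "unique_grid_min p q k s0 t0" and k: "k = s0 * t0"
    and "card (supp (Z p) g) = s0" "card (fourier_supp (Z p) g) = p - s0 + 1"
    and "card (supp (Z q) h) = t0" "card (fourier_supp (Z q) h) = q - t0 + 1"
  shows "tensor (Z p) (Z q) g h \<in> equality_cases k (Z p \<times>\<times> Z q)"
  using assms theta_eq_grid_min[OF p q min]
  by (simp add: equality_cases_def tensor_in_L card_supp_DirProd_Z
      card_fourier_supp_tensor[OF group_Z group_Z] grid_value_def)

lemma equality_cases_nonempty_iff:
  assumes p: "prime p" and q: "prime q" and min: "unique_grid_min p q k s0 t0"
  shows "equality_cases k (Z p \<times>\<times> Z q) \<noteq> {} \<longleftrightarrow> k = s0 * t0"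
proof
  assume "equality_cases k (Z p \<times>\<times> Z q) \<noteq> {}"
  then obtain f where "f \<in> equality_cases k (Z p \<times>\<times> Z q)" by blast
  then show "k = s0 * t0" by (rule equality_cases_structure[OF p q min])
next
  assume k: "k = s0 * t0"
  have m: "1 \<le> s0" "s0 \<le> p" "1 \<le> t0" "t0 \<le> q"
    using min by (auto simp: unique_grid_min_def)
  obtain g where g: "card (supp (Z p) g) = s0" "card (fourier_supp (Z p) g) = p - s0 + 1"
    using uncertainty_Z_sharp[OF p m(1,2)] by metis
  obtain h where h: "card (supp (Z q) h) = t0" "card (fourier_supp (Z q) h) = q - t0 + 1"
    using uncertainty_Z_sharp[OF q m(3,4)] by metis
  show "equality_cases k (Z p \<times>\<times> Z q) \<noteq> {}"
    using tensor_in_equality_cases[OF p q min k g h] by blast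
qed

subsection \<open>Locating the minimiser\<close>

lemma unique_grid_minD:
  assumes "unique_grid_min p q k s0 t0"
  shows "1 \<le> s0" "s0 \<le> p" "1 \<le> t0" "t0 \<le> q" "s0 * t0 \<le> k"
  using assms by (auto simp: unique_grid_min_def)

text \<open>Uniqueness being given, a non-strict comparison with one admissible candidate is enough
  to locate the minimiser.\<close>

lemma unique_grid_min_eqI:
  assumes "unique_grid_min p q k s0 t0"
    and "1 \<le> s" "s \<le> p" "1 \<le> t" "t \<le> q" "s * t \<le> k"
    and "grid_value p q s t \<le> grid_value p q s0 t0"
  shows "s0 = s \<and> t0 = t"
  using assms unfolding unique_grid_min_def by (metis le_antisym)

lemma of_nat_grid_value:
  "\<lbrakk>s \<le> p; t \<le> q\<rbrakk> \<Longrightarrow>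
    of_nat (grid_value p q s t) = (of_nat p - of_nat s + 1) * (of_nat q - of_nat t + 1 :: 'a::comm_ring_1)"
  by (simp only: grid_value_def of_nat_mult of_nat_add of_nat_diff of_nat_1)

lemma F_eq_grid_value:
  "\<lbrakk>s \<le> p; t \<le> q\<rbrakk> \<Longrightarrow> F p q (real s, real t) = real (grid_value p q s t)"
  by (simp add: F_def of_nat_grid_value)

text \<open>Points of \<open>\<Delta> p q k\<close> with coordinates in \<open>\<nat>\<close> are
  images of pairs of natural numbers, and on them \<open>F\<close> and \<open>grid_value\<close>
  agree.\<close>

lemma MM_unique_grid_min:
  assumes "k \<in> \<MM> p q"
  obtains s0 t0 where "unique_grid_min p q k s0 t0"
proof -
  let ?P = "\<lambda>z. z \<in> \<Delta> p q k \<inter> (\<nat> \<times> \<nat>)"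
  obtain z where z: "is_arg_min (F p q) ?P z"
    and uniq: "\<And>z'. is_arg_min (F p q) ?P z' \<Longrightarrow> z' = z"
    using assms unfolding \<MM>_def by (auto elim!: ex1E)
  have P: "?P (real s, real t) \<longleftrightarrow> 1 \<le> s \<and> s \<le> p \<and> 1 \<le> t \<and> t \<le> q \<and> s * t \<le> k" for s t
    unfolding \<Delta>_def by (auto simp flip: of_nat_mult)
  obtain s0 t0 where z0: "z = (real s0, real t0)"
    using z by (auto simp: is_arg_min_def elim!: Nats_cases)
  have v0: "1 \<le> s0 \<and> s0 \<le> p \<and> 1 \<le> t0 \<and> t0 \<le> q \<and> s0 * t0 \<le> k"
    using z unfolding is_arg_min_def z0 P by simp
  have le: "grid_value p q s0 t0 \<le> grid_value p q s t"
    if "1 \<le> s \<and> s \<le> p \<and> 1 \<le> t \<and> t \<le> q \<and> s * t \<le> k" for s t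
  proof -
    have "\<not> F p q (real s, real t) < F p q z"
      using z that unfolding is_arg_min_def P[symmetric] by blast
    then show ?thesis using that v0 by (simp add: z0 F_eq_grid_value)
  qed
  have eq: "s = s0 \<and> t = t0"
    if v: "1 \<le> s \<and> s \<le> p \<and> 1 \<le> t \<and> t \<le> q \<and> s * t \<le> k"
      and e: "grid_value p q s t = grid_value p q s0 t0" for s t
  proof -
    have "F p q (real s, real t) = F p q z"
      using v v0 e by (simp add: z0 F_eq_grid_value)
    then have "is_arg_min (F p q) ?P (real s, real t)"
      using z v unfolding is_arg_min_def P[symmetric] by simp
    then show ?thesis using uniq z0 by fastforce
  qed
  show thesis
    by (rule that[of s0 t0]) (use v0 le eq in \<open>auto simp: unique_grid_min_def\<close>)
qed

text \<open>Sliding \<open>(s, t)\<close> along the hyperbola of constant \<open>s * t\<close> to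
  \<open>(1, s * t)\<close> lowers the value by \<open>(s - 1) * (t * (p + 1) - (q + 1))\<close>,
  which is nonnegative; raising \<open>s * t\<close> to \<open>k\<close> lowers it further.\<close>

lemma grid_min_le_small:
  assumes min: "unique_grid_min p q k s0 t0" and k: "1 \<le> k" "k \<le> q" and "q < p"
  shows "s0 = 1 \<and> t0 = k"
proof (rule unique_grid_min_eqI[OF min])
  note m = unique_grid_minD[OF min]
  define s t where "s = int s0" and "t = int t0"
  have st: "1 \<le> s" "1 \<le> t" "s * t \<le> int k"
    using m by (auto simp: s_def t_def simp flip: of_nat_mult)
  have "(int q + 1 - t) * (int p + 1 - s) - int p * (int q + 1 - s * t)
      = (s - 1) * (t * (int p + 1) - (int q + 1))" by (simp add: algebra_simps)
  moreover have "int q + 1 \<le> t * (int p + 1)"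
  proof -
    have "1 * (int p + 1) \<le> t * (int p + 1)" using st by (intro mult_right_mono) auto
    moreover have "int q + 1 \<le> 1 * (int p + 1)" using assms(4) by simp
    ultimately show ?thesis by (rule order_trans[rotated])
  qed
  then have "0 \<le> (s - 1) * (t * (int p + 1) - (int q + 1))"
    using st by (intro mult_nonneg_nonneg) auto
  ultimately have "int p * (int q + 1 - s * t) \<le> (int q + 1 - t) * (int p + 1 - s)"
    by linarith
  moreover have "int p * (int q + 1 - int k) \<le> int p * (int q + 1 - s * t)"
    using st by (intro mult_left_mono) auto
  ultimately have "int p * (int q + 1 - int k) \<le> (int p + 1 - s) * (int q + 1 - t)"
    by (simp add: mult.commute)
  moreover have "int (grid_value p q 1 k) = int p * (int q + 1 - int k)"
    using assms by (simp add: of_nat_grid_value algebra_simps)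
  moreover have "int (grid_value p q s0 t0) = (int p + 1 - s) * (int q + 1 - t)"
    using m by (simp add: of_nat_grid_value s_def t_def algebra_simps)
  ultimately show "grid_value p q 1 k \<le> grid_value p q s0 t0" by linarith
qed (use assms in auto)

text \<open>The left side is the value at \<open>(k div q, q)\<close> when
  \<open>k div q \<le> p\<close>. Sliding along the hyperbola to the real point
  \<open>(s * t / q, q)\<close> does not increase the value, because the change is
  \<open>(q - t) * (q * (p + 1) - s * (q + 1)) / q\<close> and \<open>cond\<close> makes it
  nonnegative. Integrality of the grid value then allows \<open>k / q\<close> to be rounded
  down.\<close>

lemma grid_value_div_le:
  assumes "1 \<le> s" "s \<le> p" "1 \<le> t" "t \<le> q" "s * t \<le> k"
    and cond: "s \<le> q * (p + 1 - s)"
  shows "p - k div q + 1 \<le> grid_value p q s t"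
proof (rule ccontr)
  obtain a where a: "p = s + a" using assms le_Suc_ex by blast
  obtain b where b: "q = t + b" using assms le_Suc_ex by blast
  define m where "m = k div q"
  have "grid_value p q s t = (a + 1) * (b + 1)" by (simp add: grid_value_def a b)
  moreover assume "\<not> ?thesis"
  \<comment> \<open>This covers \<open>k div q > p\<close>, where truncation reduces the claimed
    bound to 1.\<close>
  moreover have "1 \<le> (a + 1) * (b + 1)" by simp
  ultimately have "(a + 1) * (b + 1) + m \<le> s + a" unfolding m_def a by linarith
  then have "m + 1 + b * (a + 1) \<le> s" by (simp add: algebra_simps)
  then have "q * (m + 1 + b * (a + 1)) \<le> q * s" by (rule mult_le_mono2)
  then have "q * (m + 1) + b * (q * (a + 1)) \<le> t * s + b * s"
    by (simp add: b algebra_simps)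
  moreover have "b * s \<le> b * (q * (a + 1))"
    using cond by (intro mult_le_mono2) (simp add: a)
  ultimately have "q * (m + 1) \<le> t * s" by linarith
  moreover have "k < q * (m + 1)"
    using assms dividend_less_times_div[of q k] by (simp add: m_def)
  ultimately show False using assms(5) by (simp add: mult.commute)
qed

text \<open>The previous bound with the two factors exchanged; its side condition is automatic since
  \<open>t0 \<le> q < p\<close>.\<close>

lemma grid_min_large:
  assumes min: "unique_grid_min p q k s0 t0" and k: "p \<le> k" "k < p * q" and qp: "q < p"
  shows "s0 = p \<and> t0 = k div p"
proof (rule unique_grid_min_eqI[OF min])
  note m = unique_grid_minD[OF min]
  have p0: "0 < p" using qp by simp
  show "1 \<le> k div p" using k p0 by (simp add: Suc_le_eq div_greater_zero_iff)
  show "k div p \<le> q" using k p0 by (simp add: less_mult_imp_div_less mult.commute less_imp_le)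
  show "p * (k div p) \<le> k" by simp
  have "t0 \<le> p * (q + 1 - t0)"
  proof -
    have "t0 \<le> p * 1" using m qp by simp
    also have "\<dots> \<le> p * (q + 1 - t0)" using m by (intro mult_le_mono2) simp
    finally show ?thesis .
  qed
  then have "q - k div p + 1 \<le> grid_value q p t0 s0"
    using m by (intro grid_value_div_le) (simp_all add: mult.commute)
  then show "grid_value p q p (k div p) \<le> grid_value p q s0 t0"
    by (simp add: grid_value_def mult.commute)
qed (use qp in auto)

text \<open>The hypothesis on \<open>k\<close> is the side condition of
  \<open>grid_value_div_le\<close> at \<open>s = k\<close>, and it passes down to every
  \<open>s0 \<le> k\<close>. It includes equality, as does its counterpart above the
  threshold.\<close>

lemma grid_min_below_threshold:
  assumes min: "unique_grid_min p q k s0 t0" and k: "q \<le> k" "k * (q + 1) \<le> q * (p + 1)"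
    and q: "1 < q" and qp: "q < p"
  shows "s0 = k div q \<and> t0 = q"
proof (rule unique_grid_min_eqI[OF min])
  note m = unique_grid_minD[OF min]
  show "1 \<le> k div q" using k q by (simp add: Suc_le_eq div_greater_zero_iff)
  have "s0 \<le> s0 * t0" using m by simp
  then have sk: "s0 \<le> k" using m by linarith
  have "q * (p + 1) < (p + 1) * (q + 1)" by simp
  then have "k * (q + 1) < (p + 1) * (q + 1)" using k by linarith
  then have "k < p + 1" by (simp only: mult_less_cancel2)
  then show "k div q \<le> p" using div_le_dividend[of k q] by linarith
  show "k div q * q \<le> k" by simp
  have "s0 * (q + 1) \<le> q * (p + 1)"
    using mult_le_mono1[OF sk, of "q + 1"] k by linarith
  then have "s0 \<le> q * (p + 1 - s0)" by (simp add: algebra_simps diff_mult_distrib2)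
  then have "p - k div q + 1 \<le> grid_value p q s0 t0"
    using m by (intro grid_value_div_le)
  then show "grid_value p q (k div q) q \<le> grid_value p q s0 t0"
    by (simp add: grid_value_def)
qed (use q in auto)

text \<open>If \<open>s0\<close> meets the side condition of \<open>grid_value_div_le\<close>, the
  value is at least that at \<open>(k div q, q)\<close>, which above the threshold is no smaller
  than that at \<open>(k, 1)\<close>. Otherwise \<open>s0\<close> is large, and sliding along the
  hyperbola to \<open>(s * t, 1)\<close> changes the value by
  \<open>(t - 1) * (s * (Q + 1) - P)\<close> in the right direction.\<close>

lemma grid_min_above_threshold:
  assumes min: "unique_grid_min p q k s0 t0" and k: "q * (p + 1) \<le> k * (q + 1)" "k \<le> p"
    and q: "1 < q" and qp: "q < p"
  shows "s0 = k \<and> t0 = 1"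
proof (rule unique_grid_min_eqI[OF min])
  note m = unique_grid_minD[OF min]
  define P Q s t where "P = int p + 1" and "Q = int q" and "s = int s0" and "t = int t0"
  have st: "1 \<le> s" "1 \<le> t" "s * t \<le> int k"
    using m by (auto simp: s_def t_def simp flip: of_nat_mult)
  have Q: "1 < Q" "0 < P" using q by (auto simp: Q_def P_def)
  have kQ: "Q * P \<le> int k * (Q + 1)"
    using k(1) unfolding P_def Q_def by (metis of_nat_1 of_nat_add of_nat_le_iff of_nat_mult)
  have v: "int (grid_value p q s0 t0) = (P - s) * (Q + 1 - t)"
    using m by (simp add: of_nat_grid_value s_def t_def P_def Q_def algebra_simps)
  have v1: "int (grid_value p q k 1) = (P - int k) * Q"
    using q k by (simp add: of_nat_grid_value P_def Q_def algebra_simps)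
  show "1 \<le> k" using k q by (cases k) auto
  show "grid_value p q k 1 \<le> grid_value p q s0 t0"
  proof (cases "s0 \<le> q * (p + 1 - s0)")
    case True
    then have "p - k div q + 1 \<le> grid_value p q s0 t0"
      using m by (intro grid_value_div_le)
    moreover have "(P - int k) * Q \<le> int (p - k div q + 1)"
    proof -
      define d where "d = int (k div q)"
      have "k div q \<le> p" using k(2) div_le_dividend[of k q] by linarith
      then have e: "int (p - k div q + 1) = P - d" by (simp add: d_def P_def of_nat_diff)
      have "q * (k div q) \<le> k" by simp
      then have "Q * d \<le> int k" unfolding Q_def d_def by (simp flip: of_nat_mult)
      \<comment> \<open>Once \<open>Q * d\<close> is bounded by \<open>int k\<close>, this product
        is what remains of \<open>Q * (P - d) - Q * ((P - int k) * Q)\<close>.\<close>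
      moreover have "0 \<le> (Q - 1) * (int k * (Q + 1) - Q * P)"
        using Q kQ by (intro mult_nonneg_nonneg) auto
      ultimately have "Q * ((P - int k) * Q) \<le> Q * (P - d)"
        by (simp add: algebra_simps)
      then have "(P - int k) * Q \<le> P - d" using Q by simp
      then show ?thesis using e by simp
    qed
    ultimately show ?thesis using v1 by linarith
  next
    case False
    then have "q * (p + 1 - s0) < s0" by simp
    then have "int q * int (p + 1 - s0) < int s0" by (simp flip: of_nat_mult)
    then have "Q * (P - s) < s" using m by (simp add: of_nat_diff Q_def P_def s_def algebra_simps)
    moreover have "1 * P \<le> Q * P" using Q by (intro mult_right_mono) auto
    ultimately have "P \<le> s * (Q + 1)" by (simp add: algebra_simps)
    then have "0 \<le> (t - 1) * (s * (Q + 1) - P)" using st by (intro mult_nonneg_nonneg) auto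
    then have "(P - s * t) * Q \<le> (P - s) * (Q + 1 - t)" by (simp add: algebra_simps)
    moreover have "(P - int k) * Q \<le> (P - s * t) * Q" using st Q by (intro mult_right_mono) auto
    ultimately show ?thesis using v v1 by linarith
  qed
qed (use k q in auto)

subsection \<open>Tensor form of the equality cases\<close>

text \<open>Here \<open>s0 = 1\<close>, so the support lies in a single row. The Dirac factor has a
  transform without zeros, and cancelling its \<open>p\<close> frequencies leaves the condition on
  the other factor.\<close>

lemma equality_cases_one_row:
  assumes p: "prime p" and q: "prime q" and min: "unique_grid_min p q k 1 k"
  shows "equality_cases k (Z p \<times>\<times> Z q) =
    {tensor (Z p) (Z q) (translate (Z p) a (dirac (Z p))) f | a f.
       a \<in> carrier (Z p) \<and> f \<in> L (Z q) \<and>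
       card (supp (Z q) f) = k \<and> card (fourier_supp (Z q) f) = q - k + 1}" (is "_ = ?R")
proof (intro equalityI subsetI)
  have p1: "p > 1" using p by (rule prime_gt_1_nat)
  have fd: "card (fourier_supp (Z p) (translate (Z p) a (dirac (Z p)))) = p" if "a \<in> carrier (Z p)" for a
    using that p1 by (simp add: fourier_supp_translate_dirac finite_carrier_Z card_dual_Z)
  {
    fix f assume "f \<in> equality_cases k (Z p \<times>\<times> Z q)"
    then obtain X Y where f: "f \<in> L (Z p \<times>\<times> Z q)"
      "card (fourier_supp (Z p \<times>\<times> Z q) f) = grid_value p q 1 k"
      "card X = 1" "card Y = k" "X \<subseteq> carrier (Z p)" "Y \<subseteq> carrier (Z q)"
      "supp (Z p \<times>\<times> Z q) f = X \<times> Y"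
      by (rule equality_cases_structure[OF p q min])
    then obtain a where a: "X = {a}" by (auto simp: card_1_singleton_iff)
    then have aG: "a \<in> carrier (Z p)" using f by simp
    define h where "h = (\<lambda>y\<in>carrier (Z q). f (a, y))"
    have hL: "h \<in> L (Z q)" by (simp add: h_def L_def)
    have f_eq: "f = tensor (Z p) (Z q) (translate (Z p) a (dirac (Z p))) h"
    proof (rule L_eqI[OF f(1) tensor_in_L])
      fix z assume "z \<in> carrier (Z p \<times>\<times> Z q)"
      then obtain x y where z: "z = (x, y)" "x \<in> carrier (Z p)" "y \<in> carrier (Z q)" by auto
      have "f (x, y) = 0" if "x \<noteq> a"
      proof (rule ccontr)
        assume "f (x, y) \<noteq> 0"
        then have "(x, y) \<in> supp (Z p \<times>\<times> Z q) f" using z by (simp add: supp_def)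
        then show False using f(7) a that by simp
      qed
      then show "f z = tensor (Z p) (Z q) (translate (Z p) a (dirac (Z p))) h z"
        using z aG by (simp add: tensor_apply translate_dirac_apply h_def)
    qed
    have "card (supp (Z p \<times>\<times> Z q) f) = card (supp (Z q) h)"
      unfolding f_eq using aG by (simp add: card_supp_DirProd_Z supp_translate_dirac)
    then have sh: "card (supp (Z q) h) = k" using f a by (simp add: card_cartesian_product)
    have "card (fourier_supp (Z p \<times>\<times> Z q) f) = p * card (fourier_supp (Z q) h)"
      unfolding f_eq by (simp add: card_fourier_supp_tensor fd[OF aG])
    then have "p * card (fourier_supp (Z q) h) = p * (q - k + 1)"
      using f(2) p1 by (simp only: grid_value_def) simp
    then have "card (fourier_supp (Z q) h) = q - k + 1" using p1 by (simp only: mult_cancel1) simp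
    then show "f \<in> ?R" using f_eq aG hL sh by blast
  next
    fix f assume "f \<in> ?R"
    then obtain a h where h: "f = tensor (Z p) (Z q) (translate (Z p) a (dirac (Z p))) h"
      "a \<in> carrier (Z p)" "card (supp (Z q) h) = k" "card (fourier_supp (Z q) h) = q - k + 1"
      by blast
    show "f \<in> equality_cases k (Z p \<times>\<times> Z q)"
      unfolding h(1) by (rule tensor_in_equality_cases[OF p q min])
        (use h p1 in \<open>simp_all add: supp_translate_dirac fd\<close>)
  }
qed

lemma equality_cases_one_column:
  assumes p: "prime p" and q: "prime q" and min: "unique_grid_min p q k k 1"
  shows "equality_cases k (Z p \<times>\<times> Z q) =
    {tensor (Z p) (Z q) f (translate (Z q) b (dirac (Z q))) | f b.
       b \<in> carrier (Z q) \<and> f \<in> L (Z p) \<and>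
       card (supp (Z p) f) = k \<and> card (fourier_supp (Z p) f) = p - k + 1}" (is "_ = ?R")
proof (intro equalityI subsetI)
  have q1: "q > 1" using q by (rule prime_gt_1_nat)
  have fd: "card (fourier_supp (Z q) (translate (Z q) b (dirac (Z q)))) = q" if "b \<in> carrier (Z q)" for b
    using that q1 by (simp add: fourier_supp_translate_dirac finite_carrier_Z card_dual_Z)
  {
    fix f assume "f \<in> equality_cases k (Z p \<times>\<times> Z q)"
    then obtain X Y where f: "f \<in> L (Z p \<times>\<times> Z q)"
      "card (fourier_supp (Z p \<times>\<times> Z q) f) = grid_value p q k 1"
      "card X = k" "card Y = 1" "X \<subseteq> carrier (Z p)" "Y \<subseteq> carrier (Z q)"
      "supp (Z p \<times>\<times> Z q) f = X \<times> Y"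
      by (rule equality_cases_structure[OF p q min])
    then obtain b where b: "Y = {b}" by (auto simp: card_1_singleton_iff)
    then have bG: "b \<in> carrier (Z q)" using f by simp
    define h where "h = (\<lambda>x\<in>carrier (Z p). f (x, b))"
    have hL: "h \<in> L (Z p)" by (simp add: h_def L_def)
    have f_eq: "f = tensor (Z p) (Z q) h (translate (Z q) b (dirac (Z q)))"
    proof (rule L_eqI[OF f(1) tensor_in_L])
      fix z assume "z \<in> carrier (Z p \<times>\<times> Z q)"
      then obtain x y where z: "z = (x, y)" "x \<in> carrier (Z p)" "y \<in> carrier (Z q)" by auto
      have "f (x, y) = 0" if "y \<noteq> b"
      proof (rule ccontr)
        assume "f (x, y) \<noteq> 0"
        then have "(x, y) \<in> supp (Z p \<times>\<times> Z q) f" using z by (simp add: supp_def)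
        then show False using f(7) b that by simp
      qed
      then show "f z = tensor (Z p) (Z q) h (translate (Z q) b (dirac (Z q))) z"
        using z bG by (simp add: tensor_apply translate_dirac_apply h_def)
    qed
    have "card (supp (Z p \<times>\<times> Z q) f) = card (supp (Z p) h)"
      unfolding f_eq using bG by (simp add: card_supp_DirProd_Z supp_translate_dirac)
    then have sh: "card (supp (Z p) h) = k" using f b by (simp add: card_cartesian_product)
    have "card (fourier_supp (Z p \<times>\<times> Z q) f) = card (fourier_supp (Z p) h) * q"
      unfolding f_eq by (simp add: card_fourier_supp_tensor fd[OF bG])
    then have "card (fourier_supp (Z p) h) * q = (p - k + 1) * q"
      using f(2) q1 by (simp only: grid_value_def) simp
    then have "card (fourier_supp (Z p) h) = p - k + 1" using q1 by (simp only: mult_cancel2) simp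
    then show "f \<in> ?R" using f_eq bG hL sh by blast
  next
    fix f assume "f \<in> ?R"
    then obtain h b where h: "f = tensor (Z p) (Z q) h (translate (Z q) b (dirac (Z q)))"
      "b \<in> carrier (Z q)" "card (supp (Z p) h) = k" "card (fourier_supp (Z p) h) = p - k + 1"
      by blast
    show "f \<in> equality_cases k (Z p \<times>\<times> Z q)"
      unfolding h(1) by (rule tensor_in_equality_cases[OF p q min])
        (use h q1 in \<open>simp_all add: supp_translate_dirac fd\<close>)
  }
qed

text \<open>Here \<open>t0 = q\<close>, so the Fourier support shared by the nonzero rows has
  \<open>q - q + 1 = 1\<close> element: all rows are multiples of one character, with the entry at 0
  as the factor.\<close>

lemma equality_cases_full_rows:
  assumes p: "prime p" and q: "prime q" and min: "unique_grid_min p q (q * j) j q"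
  shows "equality_cases (q * j) (Z p \<times>\<times> Z q) =
    {tensor (Z p) (Z q) f \<chi> | f \<chi>.
       \<chi> \<in> carrier (dual_group (Z q)) \<and> f \<in> L (Z p) \<and>
       card (supp (Z p) f) = j \<and> card (fourier_supp (Z p) f) = p - j + 1}" (is "_ = ?R")
proof (intro equalityI subsetI)
  have q1: "q > 1" using q by (rule prime_gt_1_nat)
  have q0: "0 \<in> carrier (Z q)" using q1 by (simp add: carrier_Z)
  fix f assume "f \<in> equality_cases (q * j) (Z p \<times>\<times> Z q)"
  then obtain X Y \<Psi> where f: "f \<in> L (Z p \<times>\<times> Z q)"
    "card (fourier_supp (Z p \<times>\<times> Z q) f) = grid_value p q j q"
    "card X = j" "card Y = q" "X \<subseteq> carrier (Z p)"
    "supp (Z p \<times>\<times> Z q) f = X \<times> Y"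
    "card \<Psi> = q - q + 1" "\<forall>x\<in>X. fourier_supp (Z q) (\<lambda>y. f (x, y)) = \<Psi>"
    by (rule equality_cases_structure[OF p q min])
  then obtain \<psi> where psi: "\<Psi> = {\<psi>}" by (auto simp: card_1_singleton_iff)
  have "X \<noteq> {}" using f(3) unique_grid_minD(1)[OF min] by auto
  then have psiG: "\<psi> \<in> carrier (dual_group (Z q))" using f(8) psi by (auto simp: supp_def)
  define h where "h = (\<lambda>x\<in>carrier (Z p). f (x, 0))"
  have hL: "h \<in> L (Z p)" by (simp add: h_def L_def)
  have f_eq: "f = tensor (Z p) (Z q) h \<psi>"
  proof (rule L_eqI[OF f(1) tensor_in_L])
    fix z assume "z \<in> carrier (Z p \<times>\<times> Z q)"
    then obtain x y where z: "z = (x, y)" "x \<in> carrier (Z p)" "y \<in> carrier (Z q)" by auto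
    have "f (x, y) = f (x, 0) * \<psi> y"
    proof (cases "x \<in> X")
      case True
      then show ?thesis
        using fourier_supp_singleton_Z[OF q _ psiG z(3), of "\<lambda>y. f (x, y)"] f(8) psi by simp
    next
      case False
      then have "(x, y') \<notin> supp (Z p \<times>\<times> Z q) f" for y' using f(6) by simp
      then show ?thesis using z q0 by (simp add: supp_def)
    qed
    then show "f z = tensor (Z p) (Z q) h \<psi> z" using z by (simp add: tensor_apply h_def)
  qed
  have "card (supp (Z p \<times>\<times> Z q) f) = card (supp (Z p) h) * q"
    unfolding f_eq using q1 psiG by (simp add: card_supp_DirProd_Z card_supp_character_Z)
  then have "card (supp (Z p) h) * q = j * q"
    using f(3,4,6) by (simp only: card_cartesian_product)
  then have sh: "card (supp (Z p) h) = j" using q1 by simp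
  have "card (fourier_supp (Z p \<times>\<times> Z q) f) = card (fourier_supp (Z p) h)"
    unfolding f_eq using q1 psiG by (simp add: card_fourier_supp_tensor card_fourier_supp_character_Z)
  then have "card (fourier_supp (Z p) h) = p - j + 1"
    using f(2) by (simp add: grid_value_def)
  then show "f \<in> ?R" using f_eq psiG hL sh by blast
next
  have q1: "q > 1" using q by (rule prime_gt_1_nat)
  fix f assume "f \<in> ?R"
  then obtain h \<psi> where h: "f = tensor (Z p) (Z q) h \<psi>"
    "\<psi> \<in> carrier (dual_group (Z q))" "card (supp (Z p) h) = j" "card (fourier_supp (Z p) h) = p - j + 1"
    by blast
  show "f \<in> equality_cases (q * j) (Z p \<times>\<times> Z q)"
    unfolding h(1) by (rule tensor_in_equality_cases[OF p q min])
      (use h q1 in \<open>simp_all add: card_supp_character_Z card_fourier_supp_character_Z\<close>)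
qed

text \<open>Here \<open>s0 = p\<close>, and it is the columns that share a Fourier support with a
  single element.\<close>

lemma equality_cases_full_columns:
  assumes p: "prime p" and q: "prime q" and min: "unique_grid_min p q (p * j) p j"
  shows "equality_cases (p * j) (Z p \<times>\<times> Z q) =
    {tensor (Z p) (Z q) \<chi> f | \<chi> f.
       \<chi> \<in> carrier (dual_group (Z p)) \<and> f \<in> L (Z q) \<and>
       card (supp (Z q) f) = j \<and> card (fourier_supp (Z q) f) = q - j + 1}" (is "_ = ?R")
proof (intro equalityI subsetI)
  have p1: "p > 1" using p by (rule prime_gt_1_nat)
  have p0: "0 \<in> carrier (Z p)" using p1 by (simp add: carrier_Z)
  fix f assume "f \<in> equality_cases (p * j) (Z p \<times>\<times> Z q)"
  then obtain X Y \<Phi> where f: "f \<in> L (Z p \<times>\<times> Z q)"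
    "card (fourier_supp (Z p \<times>\<times> Z q) f) = grid_value p q p j"
    "card X = p" "card Y = j" "Y \<subseteq> carrier (Z q)"
    "supp (Z p \<times>\<times> Z q) f = X \<times> Y"
    "card \<Phi> = p - p + 1" "\<forall>y\<in>Y. fourier_supp (Z p) (\<lambda>x. f (x, y)) = \<Phi>"
    by (rule equality_cases_structure[OF p q min])
  then obtain \<psi> where psi: "\<Phi> = {\<psi>}" by (auto simp: card_1_singleton_iff)
  have "Y \<noteq> {}" using f(4) unique_grid_minD(3)[OF min] by auto
  then have psiG: "\<psi> \<in> carrier (dual_group (Z p))" using f(8) psi by (auto simp: supp_def)
  define h where "h = (\<lambda>y\<in>carrier (Z q). f (0, y))"
  have hL: "h \<in> L (Z q)" by (simp add: h_def L_def)
  have f_eq: "f = tensor (Z p) (Z q) \<psi> h"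
  proof (rule L_eqI[OF f(1) tensor_in_L])
    fix z assume "z \<in> carrier (Z p \<times>\<times> Z q)"
    then obtain x y where z: "z = (x, y)" "x \<in> carrier (Z p)" "y \<in> carrier (Z q)" by auto
    have "f (x, y) = f (0, y) * \<psi> x"
    proof (cases "y \<in> Y")
      case True
      then show ?thesis
        using fourier_supp_singleton_Z[OF p _ psiG z(2), of "\<lambda>x. f (x, y)"] f(8) psi by simp
    next
      case False
      then have "(x', y) \<notin> supp (Z p \<times>\<times> Z q) f" for x' using f(6) by simp
      then show ?thesis using z p0 by (simp add: supp_def)
    qed
    then show "f z = tensor (Z p) (Z q) \<psi> h z" using z by (simp add: tensor_apply h_def)
  qed
  have "card (supp (Z p \<times>\<times> Z q) f) = p * card (supp (Z q) h)"
    unfolding f_eq using p1 psiG by (simp add: card_supp_DirProd_Z card_supp_character_Z)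
  then have "p * card (supp (Z q) h) = p * j"
    using f(3,4,6) by (simp only: card_cartesian_product)
  then have sh: "card (supp (Z q) h) = j" using p1 by simp
  have "card (fourier_supp (Z p \<times>\<times> Z q) f) = card (fourier_supp (Z q) h)"
    unfolding f_eq using p1 psiG by (simp add: card_fourier_supp_tensor card_fourier_supp_character_Z)
  then have "card (fourier_supp (Z q) h) = q - j + 1"
    using f(2) by (simp add: grid_value_def)
  then show "f \<in> ?R" using f_eq psiG hL sh by blast
next
  have p1: "p > 1" using p by (rule prime_gt_1_nat)
  fix f assume "f \<in> ?R"
  then obtain \<psi> h where h: "f = tensor (Z p) (Z q) \<psi> h"
    "\<psi> \<in> carrier (dual_group (Z p))" "card (supp (Z q) h) = j" "card (fourier_supp (Z q) h) = q - j + 1"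
    by blast
  show "f \<in> equality_cases (p * j) (Z p \<times>\<times> Z q)"
    unfolding h(1) by (rule tensor_in_equality_cases[OF p q min])
      (use h p1 in \<open>simp_all add: card_supp_character_Z card_fourier_supp_character_Z\<close>)
qed

section \<open>Assembly of the cases according to the size of \<open>k\<close>\<close>

lemma eq_mult_div_iff_dvd: "k = k div q * q \<longleftrightarrow> q dvd k" for k q :: nat
  by (metis dvd_div_mult_self dvd_triv_right)

theorem theorem17:
  fixes p q k :: nat
  assumes "prime p" and "prime q" and "1 < q" and "q < p" and "k \<in> \<MM> p q"
  shows
    "(k \<le> q \<longrightarrow>
        equality_cases k (Z p \<times>\<times> Z q) =
          {tensor (Z p) (Z q) (translate (Z p) a (dirac (Z p))) f | a f.
             a \<in> carrier (Z p) \<and> f \<in> L (Z q) \<and>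
             card (supp (Z q) f) = k \<and> card (fourier_supp (Z q) f) = q - k + 1}) \<and>
     (q \<le> k \<and> real k < real q * ((real p + 1) / (real q + 1)) \<longrightarrow>
        (equality_cases k (Z p \<times>\<times> Z q) \<noteq> {} \<longleftrightarrow> q dvd k) \<and>
        (\<forall>j::nat. k = q * j \<and> 1 \<le> j \<and> real j < (real p + 1) / (real q + 1) \<longrightarrow>
          equality_cases k (Z p \<times>\<times> Z q) =
            {tensor (Z p) (Z q) f \<chi> | f \<chi>.
               \<chi> \<in> carrier (dual_group (Z q)) \<and> f \<in> L (Z p) \<and>
               card (supp (Z p) f) = j \<and> card (fourier_supp (Z p) f) = p - j + 1})) \<and>
     (real q * ((real p + 1) / (real q + 1)) < real k \<and> k \<le> p \<longrightarrow>
        equality_cases k (Z p \<times>\<times> Z q) =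
          {tensor (Z p) (Z q) f (translate (Z q) b (dirac (Z q))) | f b.
             b \<in> carrier (Z q) \<and> f \<in> L (Z p) \<and>
             card (supp (Z p) f) = k \<and> card (fourier_supp (Z p) f) = p - k + 1}) \<and>
     (p \<le> k \<and> k < p * q - 1 \<longrightarrow>
        (equality_cases k (Z p \<times>\<times> Z q) \<noteq> {} \<longleftrightarrow> p dvd k) \<and>
        (\<forall>j::nat. k = p * j \<and> 1 \<le> j \<and> j \<le> q - 1 \<longrightarrow>
          equality_cases k (Z p \<times>\<times> Z q) =
            {tensor (Z p) (Z q) \<chi> f | \<chi> f.
               \<chi> \<in> carrier (dual_group (Z p)) \<and> f \<in> L (Z q) \<and>
               card (supp (Z q) f) = j \<and> card (fourier_supp (Z q) f) = q - j + 1})) \<and>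
     (\<not> (k \<le> q \<or>
         (q \<le> k \<and> real k < real q * ((real p + 1) / (real q + 1))) \<or>
         (real q * ((real p + 1) / (real q + 1)) < real k \<and> k \<le> p) \<or>
         (p \<le> k \<and> k < p * q - 1)) \<longrightarrow>
        equality_cases k (Z p \<times>\<times> Z q) = {})"
proof -
  note p = assms(1) and q = assms(2) and q1 = assms(3) and qp = assms(4)
  have k: "1 < k" "k < p * q - 1" using assms(5) by (auto simp: \<MM>_def)
  obtain s0 t0 where min: "unique_grid_min p q k s0 t0"
    using MM_unique_grid_min[OF assms(5)] by blast
  note nonempty = equality_cases_nonempty_iff[OF p q min]
  \<comment> \<open>The real threshold is cleared of its denominator to match the integer conditions
    used to locate the minimiser.\<close>
  have thr: "real q * ((real p + 1) / (real q + 1)) = real (q * (p + 1)) / real (q + 1)"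
    by (simp add: algebra_simps)
  have below: "real k < real q * ((real p + 1) / (real q + 1)) \<longleftrightarrow> k * (q + 1) < q * (p + 1)"
    unfolding thr by (subst pos_less_divide_eq, simp, simp only: of_nat_mult[symmetric] of_nat_less_iff)
  have above: "real q * ((real p + 1) / (real q + 1)) < real k \<longleftrightarrow> q * (p + 1) < k * (q + 1)"
    unfolding thr by (subst pos_divide_less_eq, simp, simp only: of_nat_mult[symmetric] of_nat_less_iff)
  show ?thesis
    unfolding below above
  proof (intro conjI impI)
    assume "k \<le> q"
    then have "s0 = 1 \<and> t0 = k" using grid_min_le_small[OF min] k qp by simp
    then show "equality_cases k (Z p \<times>\<times> Z q) =
        {tensor (Z p) (Z q) (translate (Z p) a (dirac (Z p))) f | a f.
           a \<in> carrier (Z p) \<and> f \<in> L (Z q) \<and>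
           card (supp (Z q) f) = k \<and> card (fourier_supp (Z q) f) = q - k + 1}"
      using min by (intro equality_cases_one_row[OF p q]) simp
  next
    assume "q \<le> k \<and> k * (q + 1) < q * (p + 1)"
    then have st: "s0 = k div q" "t0 = q" using grid_min_below_threshold[OF min] q1 qp by auto
    show "equality_cases k (Z p \<times>\<times> Z q) \<noteq> {} \<longleftrightarrow> q dvd k"
      unfolding nonempty st by (rule eq_mult_div_iff_dvd)
    show "\<forall>j::nat. k = q * j \<and> 1 \<le> j \<and> real j < (real p + 1) / (real q + 1) \<longrightarrow>
        equality_cases k (Z p \<times>\<times> Z q) =
          {tensor (Z p) (Z q) f \<chi> | f \<chi>.
             \<chi> \<in> carrier (dual_group (Z q)) \<and> f \<in> L (Z p) \<and>
             card (supp (Z p) f) = j \<and> card (fourier_supp (Z p) f) = p - j + 1}"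
    proof (intro allI impI)
      fix j :: nat assume "k = q * j \<and> 1 \<le> j \<and> real j < (real p + 1) / (real q + 1)"
      then have j: "k = q * j" by simp
      then have "s0 = j" using st q1 by simp
      then have "unique_grid_min p q (q * j) j q" using min st j by simp
      then show "equality_cases k (Z p \<times>\<times> Z q) =
          {tensor (Z p) (Z q) f \<chi> | f \<chi>.
             \<chi> \<in> carrier (dual_group (Z q)) \<and> f \<in> L (Z p) \<and>
             card (supp (Z p) f) = j \<and> card (fourier_supp (Z p) f) = p - j + 1}"
        unfolding j by (rule equality_cases_full_rows[OF p q])
    qed
  next
    assume "q * (p + 1) < k * (q + 1) \<and> k \<le> p"
    then have "s0 = k \<and> t0 = 1" using grid_min_above_threshold[OF min] q1 qp by simp
    then show "equality_cases k (Z p \<times>\<times> Z q) =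
        {tensor (Z p) (Z q) f (translate (Z q) b (dirac (Z q))) | f b.
           b \<in> carrier (Z q) \<and> f \<in> L (Z p) \<and>
           card (supp (Z p) f) = k \<and> card (fourier_supp (Z p) f) = p - k + 1}"
      using min by (intro equality_cases_one_column[OF p q]) simp
  next
    assume "p \<le> k \<and> k < p * q - 1"
    then have st: "s0 = p" "t0 = k div p" using grid_min_large[OF min] qp by auto
    show "equality_cases k (Z p \<times>\<times> Z q) \<noteq> {} \<longleftrightarrow> p dvd k"
      unfolding nonempty st by (subst mult.commute) (rule eq_mult_div_iff_dvd)
    show "\<forall>j::nat. k = p * j \<and> 1 \<le> j \<and> j \<le> q - 1 \<longrightarrow>
        equality_cases k (Z p \<times>\<times> Z q) =
          {tensor (Z p) (Z q) \<chi> f | \<chi> f.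
             \<chi> \<in> carrier (dual_group (Z p)) \<and> f \<in> L (Z q) \<and>
             card (supp (Z q) f) = j \<and> card (fourier_supp (Z q) f) = q - j + 1}"
    proof (intro allI impI)
      fix j :: nat assume "k = p * j \<and> 1 \<le> j \<and> j \<le> q - 1"
      then have j: "k = p * j" by simp
      then have "t0 = j" using st qp by simp
      then have "unique_grid_min p q (p * j) p j" using min st j by simp
      then show "equality_cases k (Z p \<times>\<times> Z q) =
          {tensor (Z p) (Z q) \<chi> f | \<chi> f.
             \<chi> \<in> carrier (dual_group (Z p)) \<and> f \<in> L (Z q) \<and>
             card (supp (Z q) f) = j \<and> card (fourier_supp (Z q) f) = q - j + 1}"
        unfolding j by (rule equality_cases_full_columns[OF p q])
    qed
  next
    assume "\<not> (k \<le> q \<or> (q \<le> k \<and> k * (q + 1) < q * (p + 1)) \<or>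
        (q * (p + 1) < k * (q + 1) \<and> k \<le> p) \<or> (p \<le> k \<and> k < p * q - 1))"
    \<comment> \<open>Only the threshold itself remains. Both location lemmas include equality and
      yield \<open>t0 = q\<close> and \<open>t0 = 1\<close>, which is contradictory: no
      \<open>k\<close> of \<open>\<MM> p q\<close> lies there.\<close>
    then have "q \<le> k" "k \<le> p" "k * (q + 1) = q * (p + 1)" using k by auto
    then have "t0 = q" "t0 = 1"
      using grid_min_below_threshold[OF min] grid_min_above_threshold[OF min] q1 qp by auto
    then show "equality_cases k (Z p \<times>\<times> Z q) = {}" using q1 by simp
  qed
qed

end
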